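(* Let $k$ be the algebraic closure of the rational function field $\mathbb{F}_3(t)$. Then there is a subgroup $G$ of $\mathrm{GL}_3(k)$ of order $9$ such that the invariant ring $k[x_1,x_2,x_3]^G$ does not have finite Frobenius representation type (FFRT).
   Context: $G \subset \mathrm{GL}_3(k)$ acts on the polynomial ring $k[x_1,x_2,x_3] = \mathrm{Sym}(k^3)$ by degree-preserving $k$-algebra automorphisms extending its linear action on $k^3$, where $x_1,x_2,x_3$ are the standard basis vectors of $k^3$. The polynomial ring has the standard $\mathbb{N}$-grading ($\deg x_i = 1$), and the invariant ring inherits this grading. FFRT: let $k$ be a perfect field of characteristic $p>0$, and let $R$ be a positively graded finitely generated commutative $k$-algebra (i.e., $R$ is $\mathbb{N}$-graded with $[R]_0=k$). For an integer $e\ge 0$, let ${}^eR=\{{}^er \mid r\in R\}$ be a copy of the ring $R$, regarded as an $R$-module via $r\cdot {}^es = {}^e(r^{p^e}s)$, with the $\mathbb{Q}$-grading in which $\deg {}^er = (\deg r)/p^e$ for $r$ homogeneous (for $R$ reduced, ${}^eR$ is identified with $R^{1/p^e}$, with ${}^er$ corresponding to $r^{1/p^e}$). For a $\mathbb{Q}$-graded module $M$ and $d\in\mathbb{Q}$, $M(d)$ denotes the degree shift $[M(d)]_i=[M]_{d+i}$. The ring $R$ has FFRT (in the graded sense) if there exist finitely many finitely generated $\mathbb{Q}$-graded $R$-modules $M_1,\dots,M_\ell$ such that for each $e\ge 1$, the module ${}^eR$ is isomorphic, as a $\mathbb{Q}$-graded $R$-module, to a finite direct sum of copies of modules of the form $M_i(d)$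 with $1\le i\le \ell$ and $d\in\mathbb{Q}$. *)

theory Defs
  imports
    "HOL-Analysis.Cartesian_Space"
    "HOL-Library.Poly_Mapping"
    "HOL-Algebra.Module"
    "HOL-Algebra.Ideal"
    "HOL-Algebra.Algebraic_Closure_Type"
    "Berlekamp_Zassenhaus.Finite_Field"
begin

text \<open>With this instance, \<open>3 mod_ring\<close> is the field with three elements.\<close>

instance bit1 :: (CARD_1) prime_card
proof
  show "prime CARD('a bit1)"
    by (simp add: CARD_1)
qed

type_synonym K = "3 mod_ring poly fract alg_closure"

lemma CHAR_fract: "CHAR('a::idom fract) = CHAR('a)"
proof (rule CHAR_eqI)
  show "of_nat CHAR('a) = (0 :: 'a fract)"
    by (simp add: of_nat_fract Zero_fract_def)
next
  fix n assume "of_nat n = (0 :: 'a fract)"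
  then show "CHAR('a) dvd n"
    by (simp add: of_nat_fract Zero_fract_def eq_fract of_nat_eq_0_iff_char_dvd)
qed

lemma CHAR_K: "CHAR(K) = 3"
  by (simp add: CHAR_fract)


section \<open>Linear group actions on polynomial rings\<close>

text \<open>Polynomials with coefficients in \<open>'k\<close> and one variable for each element of \<open>'n\<close>;
  the exponent vectors are the finitely supported functions \<open>'n \<Rightarrow>\<^sub>0 nat\<close>.\<close>

type_synonym ('n, 'k) mpoly = "('n \<Rightarrow>\<^sub>0 nat) \<Rightarrow>\<^sub>0 'k"

definition GL :: "('k::field^'n^'n) monoid" where
  "GL = \<lparr>carrier = {A. invertible A}, monoid.mult = (**), one = mat 1\<rparr>"

text \<open>The inclusion of the vector space \<open>'k^'n\<close> in its symmetric algebra as the linear forms;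
  the standard basis vector \<open>axis i 1\<close> becomes the variable with index \<open>i\<close>.\<close>

definition linear_form :: "'k::field^'n \<Rightarrow> ('n, 'k) mpoly" where
  "linear_form v = (\<Sum>i\<in>UNIV. Poly_Mapping.single (Poly_Mapping.single i 1) (v $ i))"

text \<open>The algebra endomorphism that extends \<open>v \<mapsto> A *v v\<close>; see \<open>act_linear_form\<close>.\<close>

definition act :: "'k::field^'n^'n \<Rightarrow> ('n, 'k) mpoly \<Rightarrow> ('n, 'k) mpoly" where
  "act A f = (\<Sum>m\<in>Poly_Mapping.keys f. Poly_Mapping.single 0 (Poly_Mapping.lookup f m) *
     (\<Prod>j\<in>UNIV. linear_form (A *v axis j 1) ^ Poly_Mapping.lookup m j))"

abbreviation (input) monomial_image where
  "monomial_image A m \<equiv> (\<Prod>j\<in>UNIV. linear_form (A *v axis j 1) ^ Poly_Mapping.lookup m j)"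

lemma act_superset:
  assumes "finite S" "Poly_Mapping.keys f \<subseteq> S"
  shows "act A f = (\<Sum>m\<in>S. Poly_Mapping.single 0 (Poly_Mapping.lookup f m) * monomial_image A m)"
  unfolding act_def using assms by (intro sum.mono_neutral_left) (auto simp: in_keys_iff)

lemma act_add: "act A (f + g) = act A f + act A g"
proof -
  let ?S = "Poly_Mapping.keys f \<union> Poly_Mapping.keys g"
  show ?thesis
    using act_superset[of ?S "f + g" A] act_superset[of ?S f A] act_superset[of ?S g A]
      keys_add[of f g]
    by (simp add: lookup_add single_add algebra_simps sum.distrib)
qed

lemma act_single: "act A (Poly_Mapping.single m c) = Poly_Mapping.single 0 c * monomial_image A m"
  by (simp add: act_def)

lemma act_0: "act A 0 = 0" by (simp add: act_def)

lemma act_const: "act A (Poly_Mapping.single 0 c) = Poly_Mapping.single 0 c"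
  by (simp add: act_single)

lemma single_sum: "Poly_Mapping.single x (\<Sum>i\<in>I. f i) = (\<Sum>i\<in>I. Poly_Mapping.single x (f i))"
  by (induction I rule: infinite_finite_induct) (auto simp: single_add)

lemma act_sum: "act A (\<Sum>i\<in>I. f i) = (\<Sum>i\<in>I. act A (f i))"
  by (induction I rule: infinite_finite_induct) (auto simp: act_0 act_add)

lemma poly_as_sum: "(f :: _ \<Rightarrow>\<^sub>0 'k::comm_monoid_add) = (\<Sum>m\<in>Poly_Mapping.keys f. Poly_Mapping.single m (Poly_Mapping.lookup f m))"
  by (rule poly_mapping_eqI) (auto simp: lookup_sum lookup_single when_def in_keys_iff sum.delta)

lemma single_0_mult: "Poly_Mapping.single 0 (c * d) = Poly_Mapping.single 0 c * Poly_Mapping.single 0 d"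
  by (simp add: mult_single)

lemma act_mult: "act A (f * g) = act A f * act A g"
proof -
  have 1: "act A (Poly_Mapping.single m c * Poly_Mapping.single n d) =
      act A (Poly_Mapping.single m c) * act A (Poly_Mapping.single n d)" for m n c d
    unfolding mult_single act_single
    by (simp add: single_0_mult lookup_add power_add prod.distrib mult_ac)
  have "act A (f * g) = act A ((\<Sum>m\<in>Poly_Mapping.keys f. Poly_Mapping.single m (Poly_Mapping.lookup f m)) * (\<Sum>m\<in>Poly_Mapping.keys g. Poly_Mapping.single m (Poly_Mapping.lookup g m)))"
    by (simp only: poly_as_sum[symmetric])
  also have "\<dots> = (\<Sum>m\<in>Poly_Mapping.keys f. act A (Poly_Mapping.single m (Poly_Mapping.lookup f m))) * (\<Sum>m\<in>Poly_Mapping.keys g. act A (Poly_Mapping.single m (Poly_Mapping.lookup g m)))"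
    by (simp add: sum_product act_sum 1)
  also have "\<dots> = act A f * act A g"
    by (simp only: act_sum[symmetric] poly_as_sum[symmetric])
  finally show ?thesis .
qed

lemma act_variable:
  fixes A :: "'k::field^'n^'n"
  shows "act A (linear_form (axis j 1)) = linear_form (A *v axis j 1)"
proof -
  have "linear_form (axis j 1 :: 'k^'n) = Poly_Mapping.single (Poly_Mapping.single j 1) 1"
    by (subst linear_form_def, subst sum.mono_neutral_right[of _ "{j}"]) (auto simp: axis_def)
  moreover have "monomial_image A (Poly_Mapping.single j 1) = linear_form (A *v axis j 1)"
    by (subst prod.mono_neutral_right[of _ "{j}"]) (auto simp: lookup_single when_def)
  ultimately show ?thesis by (simp only: act_single) simp
qed

lemma act_linear_form:
  fixes A :: "'k::field^'n^'n"
  shows "act A (linear_form v) = linear_form (A *v v)"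
proof -
  have comp: "(A *v axis i 1) $ n = A $ n $ i" for i n
    by (simp add: matrix_vector_mult_def axis_def if_distrib[of "(*) _"] cong: if_cong)
  have v: "Poly_Mapping.single (Poly_Mapping.single i 1) (v $ i) = Poly_Mapping.single 0 (v $ i) * linear_form (axis i 1)" for i
    by (simp add: linear_form_def sum_distrib_left mult_single axis_def if_distrib[of "Poly_Mapping.single _"] cong: if_cong)
  have "act A (linear_form v) = (\<Sum>i\<in>UNIV. Poly_Mapping.single 0 (v $ i) * linear_form (A *v axis i 1))"
    unfolding linear_form_def[of v] v by (simp add: act_sum act_mult act_const act_variable)
  also have "\<dots> = linear_form (A *v v)"
    unfolding linear_form_def comp
    by (simp add: sum_distrib_left mult_single matrix_vector_mult_def single_sum mult.commute) (rule sum.swap)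
  finally show ?thesis .
qed

definition homogeneous :: "nat \<Rightarrow> ('n::finite, 'k::zero) mpoly \<Rightarrow> bool" where
  "homogeneous d f \<longleftrightarrow>
     (\<forall>m\<in>Poly_Mapping.keys f. (\<Sum>i\<in>UNIV. Poly_Mapping.lookup m i) = d)"


section \<open>Graded rings and modules\<close>

record 'a graded_ring = "'a ring" +
  ring_part :: "nat \<Rightarrow> 'a set"

definition invariant_ring :: "('k::field^'n^'n) set \<Rightarrow> ('n, 'k) mpoly graded_ring" where
  "invariant_ring G =
     \<lparr>carrier = {f. \<forall>A\<in>G. act A f = f}, monoid.mult = (*), one = 1, zero = 0, add = (+),
      ring_part = (\<lambda>d. {f. (\<forall>A\<in>G. act A f = f) \<and> homogeneous d f})\<rparr>"

lemma cring_invariant_ring: "cring (invariant_ring G)"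
proof (intro cringI abelian_groupI comm_monoidI)
  fix x assume "x \<in> carrier (invariant_ring G)"
  moreover have "act A (- x) = - act A x" for A
    using act_add[of A x "-x"] by (simp add: act_0 add_eq_0_iff)
  ultimately show "\<exists>y\<in>carrier (invariant_ring G). y \<oplus>\<^bsub>invariant_ring G\<^esub> x = \<zero>\<^bsub>invariant_ring G\<^esub>"
    by (intro bexI[of _ "- x"]) (auto simp: invariant_ring_def)
next
  show "\<one>\<^bsub>invariant_ring G\<^esub> \<in> carrier (invariant_ring G)"
    by (simp add: invariant_ring_def act_const[of _ 1, simplified])
qed (simp_all add: invariant_ring_def act_add act_mult act_0 algebra_simps)

text \<open>As in \<open>HOL-Algebra\<close>, the fields \<open>mult\<close> and \<open>one\<close> of a module are irrelevant.\<close>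

record ('a, 'm) graded_module = "('a, 'm) module" +
  mod_part :: "rat \<Rightarrow> 'm set"

locale graded_module = Module.module R M
  for R :: "'a graded_ring" (structure) and M :: "('a, 'm) graded_module" (structure) +
  assumes part_additive_subgroup: "additive_subgroup (mod_part M q) M"
    and smult_part: "\<lbrakk>r \<in> ring_part R n; x \<in> mod_part M q\<rbrakk>
      \<Longrightarrow> r \<odot>\<^bsub>M\<^esub> x \<in> mod_part M (of_nat n + q)"
    and decomposition: "x \<in> carrier M \<Longrightarrow>
      \<exists>!c. (\<forall>q. c q \<in> mod_part M q) \<and> finite {q. c q \<noteq> \<zero>\<^bsub>M\<^esub>} \<and>
           x = (\<Oplus>\<^bsub>M\<^esub>q\<in>{q. c q \<noteq> \<zero>\<^bsub>M\<^esub>}. c q)"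

definition finitely_generated :: "'a graded_ring \<Rightarrow> ('a, 'm) graded_module \<Rightarrow> bool" where
  "finitely_generated R M \<longleftrightarrow>
     (\<exists>S. finite S \<and> S \<subseteq> carrier M \<and>
        (\<forall>x\<in>carrier M. \<exists>a\<in>S \<rightarrow> carrier R. x = (\<Oplus>\<^bsub>M\<^esub>s\<in>S. a s \<odot>\<^bsub>M\<^esub> s)))"

definition graded_iso ::
  "'a graded_ring \<Rightarrow> ('a, 'm) graded_module \<Rightarrow> ('a, 'n) graded_module \<Rightarrow> bool" where
  "graded_iso R M N \<longleftrightarrow>
     (\<exists>h. bij_betw h (carrier M) (carrier N) \<and>
        (\<forall>x\<in>carrier M. \<forall>y\<in>carrier M. h (x \<oplus>\<^bsub>M\<^esub> y) = h x \<oplus>\<^bsub>N\<^esub> h y) \<and>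
        (\<forall>a\<in>carrier R. \<forall>x\<in>carrier M. h (a \<odot>\<^bsub>M\<^esub> x) = a \<odot>\<^bsub>N\<^esub> h x) \<and>
        (\<forall>q. h ` mod_part M q = mod_part N q))"

text \<open>The module \<open>M(d)\<close>.\<close>

definition shift :: "('a, 'm) graded_module \<Rightarrow> rat \<Rightarrow> ('a, 'm) graded_module" where
  "shift M d = M\<lparr>mod_part := (\<lambda>q. mod_part M (d + q))\<rparr>"

definition direct_sum :: "('a, 'm) graded_module list \<Rightarrow> ('a, nat \<Rightarrow> 'm) graded_module" where
  "direct_sum Ns =
     \<lparr>carrier = (\<Pi>\<^sub>E i\<in>{..<length Ns}. carrier (Ns ! i)),
      monoid.mult = undefined, one = undefined,
      zero = (\<lambda>i\<in>{..<length Ns}. \<zero>\<^bsub>Ns ! i\<^esub>),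
      add = (\<lambda>f g. \<lambda>i\<in>{..<length Ns}. f i \<oplus>\<^bsub>Ns ! i\<^esub> g i),
      module.smult = (\<lambda>a f. \<lambda>i\<in>{..<length Ns}. a \<odot>\<^bsub>Ns ! i\<^esub> f i),
      mod_part = (\<lambda>q. \<Pi>\<^sub>E i\<in>{..<length Ns}. mod_part (Ns ! i) q)\<rparr>"


section \<open>Finite Frobenius representation type\<close>

text \<open>The module \<open>\<^sup>eR\<close>: the element \<open>s\<close> of the carrier stands for \<open>\<^sup>es\<close>.  The zero element has
  to be added to the homogeneous parts because there may be no \<open>d\<close> with \<open>d / p ^ e = q\<close>.\<close>

definition frobenius_module :: "nat \<Rightarrow> nat \<Rightarrow> 'a graded_ring \<Rightarrow> ('a, 'a) graded_module" where
  "frobenius_module p e R =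
     \<lparr>carrier = carrier R, monoid.mult = monoid.mult R, one = one R, zero = zero R, add = add R,
      module.smult = (\<lambda>r s. (r [^]\<^bsub>R\<^esub> (p ^ e)) \<otimes>\<^bsub>R\<^esub> s),
      mod_part = (\<lambda>q. insert \<zero>\<^bsub>R\<^esub> (\<Union>d\<in>{d. of_nat d / of_nat (p ^ e) = q}. ring_part R d))\<rparr>"

definition FFRT_in :: "'m itself \<Rightarrow> nat \<Rightarrow> 'a graded_ring \<Rightarrow> bool" where
  "FFRT_in _ p R \<longleftrightarrow>
     (\<exists>Ms :: ('a, 'm) graded_module set. finite Ms \<and>
        (\<forall>M\<in>Ms. graded_module R M \<and> finitely_generated R M) \<and>
        (\<forall>e\<ge>1. \<exists>Ns :: (('a, 'm) graded_module \<times> rat) list. fst ` set Ns \<subseteq> Ms \<and>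
           graded_iso R (frobenius_module p e R) (direct_sum (map (\<lambda>(M, d). shift M d) Ns))))"

text \<open>\<open>FFRT_in\<close> only considers modules with elements in one type \<open>'m\<close>. In \<open>FFRT\<close> this type
  consists of the sets of functions \<open>nat \<Rightarrow> 'a\<close>; it contains the elements of all quotients
  of \<open>R ^ n\<close>, so that every finitely generated module has an isomorphic copy there. The lemma
  \<open>FFRT_in_imp_FFRT\<close> below confirms that no other type admits more.\<close>

definition FFRT :: "nat \<Rightarrow> 'a graded_ring \<Rightarrow> bool" where
  "FFRT p (R :: 'a graded_ring) \<longleftrightarrow> FFRT_in TYPE((nat \<Rightarrow> 'a) set) p R"


section \<open>Independence of the type of module elements\<close>

definition transport :: "('m \<Rightarrow> 'n) \<Rightarrow> ('a, 'm) graded_module \<Rightarrow> ('a, 'n) graded_module" where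
  "transport h M =
     \<lparr>carrier = h ` carrier M, monoid.mult = undefined, one = undefined, zero = h \<zero>\<^bsub>M\<^esub>,
      add = (\<lambda>x y. h (inv_into (carrier M) h x \<oplus>\<^bsub>M\<^esub> inv_into (carrier M) h y)),
      module.smult = (\<lambda>a x. h (a \<odot>\<^bsub>M\<^esub> inv_into (carrier M) h x)),
      mod_part = (\<lambda>q. h ` mod_part M q)\<rparr>"

context
  fixes R :: "'a graded_ring" and M :: "('a, 'm) graded_module" and h :: "'m \<Rightarrow> 'n" and N
  assumes M: "graded_module R M" and h: "inj_on h (carrier M)"
  defines "N \<equiv> transport h M"
begin

interpretation graded_module R M by (rule M)

lemma N_simps:
  "carrier N = h ` carrier M" "\<zero>\<^bsub>N\<^esub> = h \<zero>\<^bsub>M\<^esub>" "mod_part N q = h ` mod_part M q"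
  "x \<in> carrier M \<Longrightarrow> y \<in> carrier M \<Longrightarrow> h x \<oplus>\<^bsub>N\<^esub> h y = h (x \<oplus>\<^bsub>M\<^esub> y)"
  "x \<in> carrier M \<Longrightarrow> a \<odot>\<^bsub>N\<^esub> h x = h (a \<odot>\<^bsub>M\<^esub> x)"
  using h by (simp_all add: N_def transport_def)

lemma N_module: "Module.module R N"
proof (rule moduleI)
  show "abelian_group N"
  proof (rule abelian_groupI)
    fix x assume "x \<in> carrier N"
    then obtain y where "y \<in> carrier M" "x = h y" by (auto simp: N_simps)
    then show "\<exists>z\<in>carrier N. z \<oplus>\<^bsub>N\<^esub> x = \<zero>\<^bsub>N\<^esub>"
      by (intro bexI[of _ "h (\<ominus>\<^bsub>M\<^esub> y)"]) (auto simp: N_simps M.l_neg)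
  qed (auto simp: N_simps M.a_assoc intro!: arg_cong[of _ _ h] M.a_comm)
qed (auto simp: N_simps smult_l_distr smult_r_distr smult_assoc1 R.is_cring)

interpretation N: Module.module R N by (rule N_module)

lemma N_finsum:
  "f \<in> A \<rightarrow> carrier M \<Longrightarrow> (\<Oplus>\<^bsub>N\<^esub>i\<in>A. h (f i)) = h (\<Oplus>\<^bsub>M\<^esub>i\<in>A. f i)"
proof (induction A rule: infinite_finite_induct)
  case (infinite A)
  then show ?case by (simp add: N.M.finsum_infinite M.finsum_infinite N_simps)
next
  case empty
  then show ?case by (simp add: N_simps)
next
  case (insert x F)
  have "(\<Oplus>\<^bsub>N\<^esub>i\<in>insert x F. h (f i)) = h (f x) \<oplus>\<^bsub>N\<^esub> (\<Oplus>\<^bsub>N\<^esub>i\<in>F. h (f i))"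
    using insert by (intro N.M.finsum_insert) (auto simp: N_simps)
  also have "\<dots> = h (f x \<oplus>\<^bsub>M\<^esub> (\<Oplus>\<^bsub>M\<^esub>i\<in>F. f i))"
    using insert by (simp add: N_simps Pi_iff)
  also have "f x \<oplus>\<^bsub>M\<^esub> (\<Oplus>\<^bsub>M\<^esub>i\<in>F. f i) = (\<Oplus>\<^bsub>M\<^esub>i\<in>insert x F. f i)"
    using insert by (intro M.finsum_insert[symmetric]) auto
  finally show ?case .
qed

lemma part_subset: "mod_part M q \<subseteq> carrier M"
  using additive_subgroup.a_subset[OF part_additive_subgroup] .

lemma N_graded: "graded_module R N"
proof (intro graded_module.intro graded_module_axioms.intro N_module)
  fix q
  interpret P: additive_subgroup "mod_part M q" M by (rule part_additive_subgroup)
  show "additive_subgroup (mod_part N q) N"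
  proof
    show "mod_part N q \<subseteq> carrier (add_monoid N)"
      using part_subset by (auto simp: N_simps)
    show "x \<otimes>\<^bsub>add_monoid N\<^esub> y \<in> mod_part N q" if "x \<in> mod_part N q" "y \<in> mod_part N q" for x y
      using that by (auto simp: N_simps)
    show "\<one>\<^bsub>add_monoid N\<^esub> \<in> mod_part N q"
      by (auto simp: N_simps)
    show "inv\<^bsub>add_monoid N\<^esub> x \<in> mod_part N q" if x: "x \<in> mod_part N q" for x
    proof -
      obtain y where y: "y \<in> mod_part M q" "x = h y"
        using x by (auto simp: N_simps)
      have "\<ominus>\<^bsub>N\<^esub> x = h (\<ominus>\<^bsub>M\<^esub> y)"
        using y by (intro N.M.minus_equality) (auto simp: N_simps M.l_neg)
      then show ?thesis
        using y P.a_inv_closed by (auto simp: a_inv_def N_simps)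
    qed
  qed
next
  fix r n x q assume "r \<in> ring_part R n" "x \<in> mod_part N q"
  then show "r \<odot>\<^bsub>N\<^esub> x \<in> mod_part N (of_nat n + q)"
    using smult_part part_subset[of q] by (auto simp: N_simps)
next
  fix y assume "y \<in> carrier N"
  then obtain x where x: "x \<in> carrier M" "y = h x" by (auto simp: N_simps)
  let ?P = "\<lambda>c. (\<forall>q. c q \<in> mod_part M q) \<and> finite {q. c q \<noteq> \<zero>\<^bsub>M\<^esub>} \<and>
           x = (\<Oplus>\<^bsub>M\<^esub>q\<in>{q. c q \<noteq> \<zero>\<^bsub>M\<^esub>}. c q)"
  let ?Q = "\<lambda>c. (\<forall>q. c q \<in> mod_part N q) \<and> finite {q. c q \<noteq> \<zero>\<^bsub>N\<^esub>} \<and>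
           y = (\<Oplus>\<^bsub>N\<^esub>q\<in>{q. c q \<noteq> \<zero>\<^bsub>N\<^esub>}. c q)"
  have PQ: "?Q (\<lambda>q. h (c q)) \<longleftrightarrow> ?P c" if c: "\<forall>q. c q \<in> mod_part M q" for c
  proof -
    have cM: "c q \<in> carrier M" for q
      using c part_subset by auto
    have eq: "h (c q) \<noteq> \<zero>\<^bsub>N\<^esub> \<longleftrightarrow> c q \<noteq> \<zero>\<^bsub>M\<^esub>" for q
      using h cM[of q] by (auto simp: N_simps inj_on_def)
    have "y = (\<Oplus>\<^bsub>N\<^esub>q\<in>{q. c q \<noteq> \<zero>\<^bsub>M\<^esub>}. h (c q)) \<longleftrightarrow> x = (\<Oplus>\<^bsub>M\<^esub>q\<in>{q. c q \<noteq> \<zero>\<^bsub>M\<^esub>}. c q)"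
      using h x cM by (subst N_finsum) (auto simp: inj_on_eq_iff)
    then show ?thesis
      using c by (simp add: eq N_simps(3))
  qed
  from decomposition[OF x(1)] obtain c where c: "?P c" and uniq: "\<And>c'. ?P c' \<Longrightarrow> c' = c"
    by blast
  show "\<exists>!c. ?Q c"
  proof (rule ex1I[of _ "\<lambda>q. h (c q)"])
    show "?Q (\<lambda>q. h (c q))" using PQ c by blast
  next
    fix d assume d: "?Q d"
    then have "\<forall>q. \<exists>z. z \<in> mod_part M q \<and> d q = h z" by (auto simp: N_simps)
    then obtain c' where c': "\<forall>q. c' q \<in> mod_part M q" and dc: "d = (\<lambda>q. h (c' q))"
      by (metis ext)
    have "?P c'" using PQ[OF c'] d unfolding dc by blast
    from uniq[OF this] show "d = (\<lambda>q. h (c q))" by (simp add: dc)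
  qed
qed

lemma N_finitely_generated:
  assumes "finitely_generated R M"
  shows "finitely_generated R N"
proof -
  obtain S where S: "finite S" "S \<subseteq> carrier M"
    "\<And>x. x \<in> carrier M \<Longrightarrow> \<exists>a\<in>S \<rightarrow> carrier R. x = (\<Oplus>\<^bsub>M\<^esub>s\<in>S. a s \<odot>\<^bsub>M\<^esub> s)"
    using assms by (auto simp: finitely_generated_def)
  have inj: "inj_on h S" using h S(2) by (rule inj_on_subset)
  show ?thesis
    unfolding finitely_generated_def
  proof (intro exI[of _ "h ` S"] conjI ballI)
    show "finite (h ` S)" "h ` S \<subseteq> carrier N" using S by (auto simp: N_simps)
  next
    fix y assume "y \<in> carrier N"
    then obtain x where x: "x \<in> carrier M" "y = h x" by (auto simp: N_simps)
    obtain a where a: "a \<in> S \<rightarrow> carrier R" "x = (\<Oplus>\<^bsub>M\<^esub>s\<in>S. a s \<odot>\<^bsub>M\<^esub> s)"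
      using S(3)[OF x(1)] by blast
    let ?b = "\<lambda>t. a (inv_into S h t)"
    have "(\<Oplus>\<^bsub>N\<^esub>t\<in>h ` S. ?b t \<odot>\<^bsub>N\<^esub> t) = (\<Oplus>\<^bsub>N\<^esub>s\<in>S. ?b (h s) \<odot>\<^bsub>N\<^esub> h s)"
      using a(1) S(2) inj by (intro N.M.finsum_reindex) (auto simp: N_simps Pi_iff subset_iff)
    also have "\<dots> = (\<Oplus>\<^bsub>N\<^esub>s\<in>S. h (a s \<odot>\<^bsub>M\<^esub> s))"
      using a(1) S(2) inj by (intro N.M.finsum_cong') (auto simp: N_simps Pi_iff subset_iff)
    also have "\<dots> = y"
      using a S(2) x(2) by (subst N_finsum) (auto simp: Pi_iff subset_iff)
    finally show "\<exists>b\<in>h ` S \<rightarrow> carrier R. y = (\<Oplus>\<^bsub>N\<^esub>t\<in>h ` S. b t \<odot>\<^bsub>N\<^esub> t)"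
      using a(1) inj by (intro bexI[of _ ?b]) (auto simp: Pi_iff)
  qed
qed

lemma N_iso: "graded_iso R M N"
  unfolding graded_iso_def using h
  by (intro exI[of _ h]) (auto simp: N_simps bij_betw_def)

end

lemma finitely_generated_copy:
  fixes M :: "('a, 'm) graded_module"
  assumes "graded_module R M" "finitely_generated R M"
  shows "\<exists>N :: ('a, (nat \<Rightarrow> 'a) set) graded_module.
    graded_module R N \<and> finitely_generated R N \<and> graded_iso R M N"
proof -
  interpret graded_module R M by fact
  obtain S where S: "finite S" "S \<subseteq> carrier M"
    "\<And>x. x \<in> carrier M \<Longrightarrow> \<exists>a\<in>S \<rightarrow> carrier R. x = (\<Oplus>\<^bsub>M\<^esub>s\<in>S. a s \<odot>\<^bsub>M\<^esub> s)"
    using assms by (auto simp: finitely_generated_def)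
  obtain e :: "'m \<Rightarrow> nat" where e: "inj_on e S"
    using finite_imp_inj_to_nat_seg[OF S(1)] by blast
  define h where "h x = {a. (\<lambda>s. a (e s)) \<in> S \<rightarrow> carrier R \<and>
    x = (\<Oplus>\<^bsub>M\<^esub>s\<in>S. a (e s) \<odot>\<^bsub>M\<^esub> s)}" for x
  have nonempty: "h x \<noteq> {}" if x: "x \<in> carrier M" for x
  proof -
    obtain a where a: "a \<in> S \<rightarrow> carrier R" "x = (\<Oplus>\<^bsub>M\<^esub>s\<in>S. a s \<odot>\<^bsub>M\<^esub> s)"
      using S(3)[OF x] by blast
    have "x = (\<Oplus>\<^bsub>M\<^esub>s\<in>S. a (inv_into S e (e s)) \<odot>\<^bsub>M\<^esub> s)"
      unfolding a(2) using a(1) S(2) e by (intro M.finsum_cong') (auto simp: Pi_iff subset_iff)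
    then have "(\<lambda>n. a (inv_into S e n)) \<in> h x"
      using a(1) e by (auto simp: h_def Pi_iff)
    then show ?thesis by blast
  qed
  have "inj_on h (carrier M)"
  proof (rule inj_onI)
    fix x y assume "x \<in> carrier M" "y \<in> carrier M" "h x = h y"
    then obtain a where "a \<in> h x" "a \<in> h y" using nonempty by blast
    then show "x = y" by (simp add: h_def)
  qed
  then show ?thesis
    using assms by (blast intro: N_graded N_finitely_generated N_iso)
qed

lemma graded_iso_trans:
  assumes "graded_iso R L M" "graded_iso R M N"
  shows "graded_iso R L N"
proof -
  from assms(1) obtain g where
    g: "bij_betw g (carrier L) (carrier M)"
      "\<forall>x\<in>carrier L. \<forall>y\<in>carrier L. g (x \<oplus>\<^bsub>L\<^esub> y) = g x \<oplus>\<^bsub>M\<^esub> g y"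
      "\<forall>a\<in>carrier R. \<forall>x\<in>carrier L. g (a \<odot>\<^bsub>L\<^esub> x) = a \<odot>\<^bsub>M\<^esub> g x"
      "\<forall>q. g ` mod_part L q = mod_part M q"
    unfolding graded_iso_def by blast
  from assms(2) obtain h where
    h: "bij_betw h (carrier M) (carrier N)"
      "\<forall>x\<in>carrier M. \<forall>y\<in>carrier M. h (x \<oplus>\<^bsub>M\<^esub> y) = h x \<oplus>\<^bsub>N\<^esub> h y"
      "\<forall>a\<in>carrier R. \<forall>x\<in>carrier M. h (a \<odot>\<^bsub>M\<^esub> x) = a \<odot>\<^bsub>N\<^esub> h x"
      "\<forall>q. h ` mod_part M q = mod_part N q"
    unfolding graded_iso_def by blast
  have gM: "g x \<in> carrier M" if "x \<in> carrier L" for x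
    using bij_betwE[OF g(1)] that by blast
  show ?thesis
    unfolding graded_iso_def
  proof (rule exI[of _ "h \<circ> g"], intro conjI ballI allI)
    show "bij_betw (h \<circ> g) (carrier L) (carrier N)"
      by (rule bij_betw_trans[OF g(1) h(1)])
    show "(h \<circ> g) ` mod_part L q = mod_part N q" for q
      using g(4) h(4) by (simp only: image_comp[symmetric])
  qed (simp_all add: g(2,3) h(2,3) gM)
qed

lemma PiE_image:
  "(\<lambda>f. \<lambda>i\<in>I. g i (f i)) ` (\<Pi>\<^sub>E i\<in>I. A i) = (\<Pi>\<^sub>E i\<in>I. g i ` A i)"
proof (intro equalityI subsetI)
  fix f assume f: "f \<in> (\<Pi>\<^sub>E i\<in>I. g i ` A i)"
  then have "\<forall>i\<in>I. \<exists>x. x \<in> A i \<and> f i = g i x" by (auto simp: PiE_iff)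
  then obtain k where k: "\<forall>i\<in>I. k i \<in> A i \<and> f i = g i (k i)" by metis
  then have "f = (\<lambda>i\<in>I. g i (restrict k I i))"
    using f by (intro extensionalityI[of _ I]) (auto simp: PiE_iff)
  moreover have "restrict k I \<in> (\<Pi>\<^sub>E i\<in>I. A i)" using k by auto
  ultimately show "f \<in> (\<lambda>f. \<lambda>i\<in>I. g i (f i)) ` (\<Pi>\<^sub>E i\<in>I. A i)" by blast
qed (auto simp: PiE_iff)

lemma direct_sum_cong:
  assumes len: "length Ms = length Ns"
    and iso: "\<And>i. i < length Ns \<Longrightarrow> graded_iso R (Ms ! i) (Ns ! i)"
  shows "graded_iso R (direct_sum Ms) (direct_sum Ns)"
proof -
  let ?I = "{..<length Ns}"
  have "\<forall>i\<in>?I. \<exists>h. bij_betw h (carrier (Ms ! i)) (carrier (Ns ! i)) \<and>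
        (\<forall>x\<in>carrier (Ms ! i). \<forall>y\<in>carrier (Ms ! i).
           h (x \<oplus>\<^bsub>Ms ! i\<^esub> y) = h x \<oplus>\<^bsub>Ns ! i\<^esub> h y) \<and>
        (\<forall>a\<in>carrier R. \<forall>x\<in>carrier (Ms ! i). h (a \<odot>\<^bsub>Ms ! i\<^esub> x) = a \<odot>\<^bsub>Ns ! i\<^esub> h x) \<and>
        (\<forall>q. h ` mod_part (Ms ! i) q = mod_part (Ns ! i) q)"
    using iso unfolding graded_iso_def by blast
  from bchoice[OF this] obtain h where h: "\<forall>i\<in>?I. bij_betw (h i) (carrier (Ms ! i)) (carrier (Ns ! i)) \<and>
        (\<forall>x\<in>carrier (Ms ! i). \<forall>y\<in>carrier (Ms ! i).
           h i (x \<oplus>\<^bsub>Ms ! i\<^esub> y) = h i x \<oplus>\<^bsub>Ns ! i\<^esub> h i y) \<and>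
        (\<forall>a\<in>carrier R. \<forall>x\<in>carrier (Ms ! i). h i (a \<odot>\<^bsub>Ms ! i\<^esub> x) = a \<odot>\<^bsub>Ns ! i\<^esub> h i x) \<and>
        (\<forall>q. h i ` mod_part (Ms ! i) q = mod_part (Ns ! i) q)"
    by blast
  let ?H = "\<lambda>f. \<lambda>i\<in>?I. h i (f i)"
  have inj: "inj_on ?H (\<Pi>\<^sub>E i\<in>?I. carrier (Ms ! i))"
  proof (rule inj_onI)
    fix f g assume fg: "f \<in> (\<Pi>\<^sub>E i\<in>?I. carrier (Ms ! i))" "g \<in> (\<Pi>\<^sub>E i\<in>?I. carrier (Ms ! i))"
      and eq: "?H f = ?H g"
    have "f i = g i" if i: "i \<in> ?I" for i
    proof (rule inj_onD[of "h i" "carrier (Ms ! i)"])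
      show "inj_on (h i) (carrier (Ms ! i))" using h i by (auto simp: bij_betw_def)
      show "h i (f i) = h i (g i)" using fun_cong[OF eq, of i] i by simp
    qed (use fg i in \<open>auto simp: PiE_iff\<close>)
    then show "f = g" using fg by (intro PiE_ext) auto
  qed
  have img: "h i ` carrier (Ms ! i) = carrier (Ns ! i)" "h i ` mod_part (Ms ! i) q = mod_part (Ns ! i) q"
    if "i \<in> ?I" for i q
    using h that by (auto simp: bij_betw_def)
  have PiE_img: "(\<Pi>\<^sub>E i\<in>?I. h i ` carrier (Ms ! i)) = (\<Pi>\<^sub>E i\<in>?I. carrier (Ns ! i))"
    "(\<Pi>\<^sub>E i\<in>?I. h i ` mod_part (Ms ! i) q) = (\<Pi>\<^sub>E i\<in>?I. mod_part (Ns ! i) q)" for q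
    by (rule PiE_cong, erule img)+
  show ?thesis
    unfolding graded_iso_def
  proof (rule exI[of _ ?H], intro conjI ballI allI)
    show "bij_betw ?H (carrier (direct_sum Ms)) (carrier (direct_sum Ns))"
      using inj by (simp add: bij_betw_def direct_sum_def len PiE_image PiE_img(1))
    show "?H ` mod_part (direct_sum Ms) q = mod_part (direct_sum Ns) q" for q
      by (simp add: direct_sum_def len PiE_image PiE_img(2))
    show "?H (x \<oplus>\<^bsub>direct_sum Ms\<^esub> y) = ?H x \<oplus>\<^bsub>direct_sum Ns\<^esub> ?H y"
      if "x \<in> carrier (direct_sum Ms)" "y \<in> carrier (direct_sum Ms)" for x y
      using that h by (simp add: direct_sum_def len PiE_iff fun_eq_iff)
    show "?H (a \<odot>\<^bsub>direct_sum Ms\<^esub> x) = a \<odot>\<^bsub>direct_sum Ns\<^esub> ?H x"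
      if "a \<in> carrier R" "x \<in> carrier (direct_sum Ms)" for a x
      using that h by (simp add: direct_sum_def len PiE_iff fun_eq_iff)
  qed
qed

lemma shift_cong: "graded_iso R M N \<Longrightarrow> graded_iso R (shift M d) (shift N d)"
  unfolding graded_iso_def by (elim ex_forward) (simp add: shift_def)

lemma FFRT_in_imp_FFRT:
  assumes "FFRT_in TYPE('m) p R"
  shows "FFRT p R"
proof -
  obtain Ms :: "('a, 'm) graded_module set" where Ms: "finite Ms"
    "\<And>M. M \<in> Ms \<Longrightarrow> graded_module R M \<and> finitely_generated R M"
    "\<And>e. e \<ge> 1 \<Longrightarrow> \<exists>Ns. fst ` set Ns \<subseteq> Ms \<and>
       graded_iso R (frobenius_module p e R) (direct_sum (map (\<lambda>(M, d). shift M d) Ns))"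
    using assms unfolding FFRT_in_def by blast
  have "\<forall>M\<in>Ms. \<exists>N :: ('a, (nat \<Rightarrow> 'a) set) graded_module.
    graded_module R N \<and> finitely_generated R N \<and> graded_iso R M N"
    using Ms(2) finitely_generated_copy by blast
  from bchoice[OF this] obtain c :: "_ \<Rightarrow> ('a, (nat \<Rightarrow> 'a) set) graded_module" where
    c: "\<And>M. M \<in> Ms \<Longrightarrow> graded_module R (c M) \<and> finitely_generated R (c M) \<and> graded_iso R M (c M)"
    by blast
  show ?thesis
    unfolding FFRT_def FFRT_in_def
  proof (intro exI[of _ "c ` Ms"] conjI ballI allI impI)
    fix e :: nat assume "1 \<le> e"
    then obtain Ns where Ns: "fst ` set Ns \<subseteq> Ms"
       "graded_iso R (frobenius_module p e R) (direct_sum (map (\<lambda>(M, d). shift M d) Ns))"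
      using Ms(3) by blast
    let ?Ns = "map (\<lambda>(M, d). (c M, d)) Ns"
    have "graded_iso R (direct_sum (map (\<lambda>(M, d). shift M d) Ns))
      (direct_sum (map (\<lambda>(M, d). shift M d) ?Ns))"
    proof (rule direct_sum_cong)
      fix i assume "i < length (map (\<lambda>(M, d). shift M d) ?Ns)"
      then have i: "i < length Ns" by simp
      then have "fst (Ns ! i) \<in> Ms" using Ns(1) nth_mem by blast
      with i show "graded_iso R (map (\<lambda>(M, d). shift M d) Ns ! i) (map (\<lambda>(M, d). shift M d) ?Ns ! i)"
        using c by (auto simp: split_beta intro: shift_cong)
    qed simp
    from graded_iso_trans[OF Ns(2) this]
    show "\<exists>Ns. fst ` set Ns \<subseteq> c ` Ms \<and>
       graded_iso R (frobenius_module p e R) (direct_sum (map (\<lambda>(M, d). shift M d) Ns))"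
      using Ns(1) by (intro exI[of _ ?Ns]) (auto simp: image_image split_beta)
  qed (use Ms(1) c in auto)
qed

end

theory Submission
  imports Defs
begin

text \<open>
  Let \<open>J\<close> be the nilpotent \<open>3 \<times> 3\<close> Jordan block and \<open>t \<in> k\<close> transcendental over the field \<open>\<F>\<close> with
  three elements. The group \<open>G\<close> consists of the exponentials \<open>exp (a J)\<close> with
  \<open>a \<in> \<F> + \<F> t\<close>. Frobenius twists of the representation \<open>k\<^sup>3\<close> replace the slope \<open>t\<close> by
  \<open>t\<close> to the power \<open>1 / 3\<^sup>e\<close>, so the twists are pairwise non-isomorphic. As no nontrivial element
  of \<open>G\<close> is a reflection, the modules \<open>\<^sup>eR\<close> over \<open>R = S\<^sup>G\<close>, with \<open>S = k[x\<^sub>1, x\<^sub>2, x\<^sub>3]\<close>, remember these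
  twists, and finitely many modules up to shift cannot carry infinitely many of them.

  The twist is read off from the graded pieces \<open>H\<^sub>d(M)\<close> of \<open>Hom\<^sub>R(S, M)\<close>, where \<open>M\<close> is a graded
  \<open>R\<close>-module. The group acts on them through \<open>S\<close>, and so does \<open>k\<close>, and they are additive in \<open>M\<close>.
  For \<open>M = \<^sup>eR\<close> and \<open>q = 3\<^sup>e\<close>, every element of \<open>H\<^sub>d(M)\<close> has the form \<open>x \<mapsto> Tr (c x\<^sup>q)\<close> with \<open>c \<in> S\<close>
  homogeneous of degree \<open>q d\<close> (\<open>graded_hom_is_trace\<close>). This is Galois duality without
  fraction fields (\<open>semilinear_is_trace\<close>). A vector \<open>v\<close> gives elements \<open>a\<^sub>T\<close>, \<open>b\<^sub>T\<close> of \<open>S\<close> such that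
  \<open>\<Sum>\<^sub>T h(a\<^sub>T) b\<^sub>T\<close> vanishes for \<open>h \<noteq> 1\<close> and equals the product \<open>\<delta>\<^sub>v\<close> of all \<open>g v - v\<close> with \<open>g \<noteq> 1\<close> for \<open>h = 1\<close>
  (\<open>factors_orthogonal\<close>), which determines \<open>\<delta>\<^sub>v\<^sup>q c\<close>. For \<open>v = x\<^sub>2\<close> the product is a power of
  \<open>x\<^sub>1\<close> up to a constant, for \<open>v = x\<^sub>3\<close> it is prime to \<open>x\<^sub>1\<close>, and so \<open>c\<close> exists in \<open>S\<close>.

  Hence \<open>G\<close> acts trivially on \<open>H\<^sub>d(\<^sup>eR)\<close> for \<open>d < 1 / q\<close>, while \<open>H\<^sub>d(\<^sup>eR)\<close> for \<open>d = 1 / q\<close> is the space of linear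
  forms \<open>c\<close>, on which \<open>\<lambda> \<in> k\<close> acts as multiplication by \<open>\<lambda>\<^sup>q\<close>. With \<open>g\<^sub>a = exp (a J)\<close>, the operator
  \<open>(g\<^sub>1 - 1)\<^sup>2\<close> therefore vanishes in degrees below \<open>1 / q\<close> but not in degree \<open>1 / q\<close>, and there
  \<open>(g\<^sub>1 - 1) (g\<^sub>t - 1) = \<lambda> (g\<^sub>1 - 1)\<^sup>2\<close> for the root \<open>\<lambda>\<close> with \<open>\<lambda>\<^sup>q = t\<close>. If \<open>\<^sup>eR\<close> is a direct sum of
  shifts of modules from a finite list, some summand \<open>M\<close> up to shift has a least degree \<open>D\<close> in which
  \<open>(g\<^sub>1 - 1)\<^sup>2\<close> does not vanish, and \<open>\<lambda>\<close> satisfies the same relation on \<open>H\<^sub>D(M)\<close>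
  (\<open>summand_with_slope\<close>). But \<open>M\<close> determines \<open>D\<close>, and then \<open>\<lambda>\<close> (\<open>slope_unique\<close>). The roots for different
  \<open>e\<close> are distinct because \<open>t\<close> is transcendental, so the list would have to be infinite.
\<close>

section \<open>The trace form of a finite group\<close>

lemma prime_elem_power_dvd_multD:
  fixes z a b :: "'s::idom"
  assumes "prime_elem z" "z ^ n dvd a * b" "\<not> z dvd b"
  shows "z ^ n dvd a"
  using assms(2)
proof (induction n arbitrary: a)
  case (Suc n)
  then have "z dvd a * b" by (metis dvd_trans dvd_triv_left power_Suc)
  then have "z dvd a" using assms by (auto simp: prime_elem_dvd_mult_iff)
  then obtain a' where a': "a = z * a'" by (elim dvdE)
  with Suc.prems have "z ^ n dvd a' * b"
    using assms(1) by (simp add: mult.assoc prime_elem_def)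
  then have "z ^ n dvd a'" by (rule Suc.IH)
  then show ?case unfolding a' power_Suc by (rule mult_dvd_mono[OF dvd_refl])
qed simp

text \<open>The group is written additively: the application parametrizes the matrices \<open>exp (a J)\<close> by
  the scalar \<open>a\<close>. The whole type acts, and \<open>A\<close> is the finite subgroup whose invariants are studied.\<close>

locale finite_group_action =
  fixes A :: "'g::ab_group_add set" and \<sigma> :: "'g \<Rightarrow> 's::idom \<Rightarrow> 's"
  assumes finite_A: "finite A" and zero_in: "0 \<in> A"
    and diff_in: "a \<in> A \<Longrightarrow> b \<in> A \<Longrightarrow> a - b \<in> A"
    and \<sigma>_zero: "\<sigma> 0 x = x" and \<sigma>_comp: "\<sigma> (a + b) x = \<sigma> a (\<sigma> b x)"
    and \<sigma>_add: "\<sigma> a (x + y) = \<sigma> a x + \<sigma> a y"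
    and \<sigma>_mult: "\<sigma> a (x * y) = \<sigma> a x * \<sigma> a y" and \<sigma>_one: "\<sigma> a 1 = 1"
begin

lemma minus_in: "a \<in> A \<Longrightarrow> - a \<in> A"
  using diff_in[of 0 a] zero_in by simp

lemma add_in: "a \<in> A \<Longrightarrow> b \<in> A \<Longrightarrow> a + b \<in> A"
  using diff_in[of a "- b"] minus_in[of b] by simp

lemma \<sigma>_0: "\<sigma> a 0 = 0"
  using \<sigma>_add[of a 0 0] by (simp only: add_0 add_cancel_right_right)

lemma \<sigma>_minus: "\<sigma> a (- x) = - \<sigma> a x"
  using \<sigma>_add[of a "- x" x] by (simp add: \<sigma>_0 eq_neg_iff_add_eq_0)

lemma \<sigma>_diff: "\<sigma> a (x - y) = \<sigma> a x - \<sigma> a y"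
  using \<sigma>_add[of a x "- y"] by (simp add: \<sigma>_minus)

lemma \<sigma>_power: "\<sigma> a (x ^ n) = \<sigma> a x ^ n"
  by (induction n) (simp_all add: \<sigma>_one \<sigma>_mult)

lemma \<sigma>_sum: "\<sigma> a (sum f I) = (\<Sum>i\<in>I. \<sigma> a (f i))"
  by (induction I rule: infinite_finite_induct) (simp_all add: \<sigma>_0 \<sigma>_add)

lemma \<sigma>_prod: "\<sigma> a (prod f I) = (\<Prod>i\<in>I. \<sigma> a (f i))"
  by (induction I rule: infinite_finite_induct) (simp_all add: \<sigma>_one \<sigma>_mult)

definition invariant :: "'s \<Rightarrow> bool" where
  "invariant x \<longleftrightarrow> (\<forall>a\<in>A. \<sigma> a x = x)"

definition tr :: "'s \<Rightarrow> 's" where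
  "tr x = (\<Sum>a\<in>A. \<sigma> a x)"

lemma tr_add: "tr (x + y) = tr x + tr y"
  by (simp add: tr_def \<sigma>_add sum.distrib)

lemma tr_diff: "tr (x - y) = tr x - tr y"
  by (simp add: tr_def \<sigma>_diff sum_subtractf)

lemma tr_invariant_mult: "invariant r \<Longrightarrow> tr (r * x) = r * tr x"
  by (simp add: tr_def \<sigma>_mult sum_distrib_left invariant_def)

lemma tr_0: "tr 0 = 0"
  by (simp add: tr_def \<sigma>_0)

lemma tr_\<sigma>:
  assumes "b \<in> A"
  shows "tr (\<sigma> b x) = tr x"
proof -
  have "(\<Sum>a\<in>A. \<sigma> (a + b) x) = (\<Sum>a\<in>A. \<sigma> a x)"
    using assms
    by (intro sum.reindex_bij_witness[of _ "\<lambda>a. a - b" "\<lambda>a. a + b"]) (auto simp: diff_in add_in)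
  then show ?thesis by (simp add: tr_def \<sigma>_comp)
qed

lemma invariant_tr: "invariant (tr x)"
  unfolding invariant_def
proof
  fix b assume b: "b \<in> A"
  have "\<sigma> b (tr x) = (\<Sum>a\<in>A. \<sigma> (b + a) x)"
    by (simp add: tr_def \<sigma>_sum \<sigma>_comp)
  also have "\<dots> = tr x"
    unfolding tr_def using b
    by (intro sum.reindex_bij_witness[of _ "\<lambda>a. a - b" "\<lambda>a. b + a"]) (auto simp: diff_in add_in)
  finally show "\<sigma> b (tr x) = tr x" .
qed

definition diff_by :: "'g \<Rightarrow> 's \<Rightarrow> 's" where
  "diff_by a x = \<sigma> a x - x"

lemma diff_by_0: "diff_by a 0 = 0"
  by (simp add: diff_by_def \<sigma>_0)

text \<open>Expanding \<open>\<Prod>\<^sub>g (g v \<otimes> 1 - 1 \<otimes> v)\<close> in \<open>S \<otimes> S\<close>, with \<open>g\<close> running over the nontrivial group elements,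
  gives one summand \<open>a\<^sub>T \<otimes> b\<^sub>T\<close> for every set \<open>T\<close> of factors that contribute their left term. These
  are its two components.\<close>

definition left_factor :: "'s \<Rightarrow> 'g set \<Rightarrow> 's" where
  "left_factor v T = (\<Prod>g\<in>T. \<sigma> g v)"

definition right_factor :: "'s \<Rightarrow> 'g set \<Rightarrow> 's" where
  "right_factor v T = (\<Prod>g\<in>A - {0} - T. - v)"

definition discr :: "'s \<Rightarrow> 's" where
  "discr v = (\<Prod>g\<in>A - {0}. diff_by g v)"

text \<open>The sum over \<open>T\<close> is the image of the tensor \<open>\<Prod>\<^sub>g (g v \<otimes> 1 - 1 \<otimes> v)\<close> under \<open>x \<otimes> y \<mapsto> h(x) y\<close>.
  The factor of \<open>g = h\<^sup>-\<^sup>1\<close> is sent to zero unless \<open>h\<close> is the identity.\<close>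

lemma factors_orthogonal:
  assumes h: "h \<in> A"
  shows "(\<Sum>T\<in>Pow (A - {0}). \<sigma> h (left_factor v T) * right_factor v T) =
    (if h = 0 then discr v else 0)"
proof -
  have "(\<Sum>T\<in>Pow (A - {0}). \<sigma> h (left_factor v T) * right_factor v T) =
      (\<Sum>T\<in>Pow (A - {0}). (\<Prod>g\<in>T. \<sigma> (h + g) v) * (\<Prod>g\<in>A - {0} - T. - v))"
    by (simp add: left_factor_def right_factor_def \<sigma>_prod \<sigma>_comp)
  also have "\<dots> = (\<Prod>g\<in>A - {0}. \<sigma> (h + g) v + - v)"
    by (rule prod_add[symmetric]) (simp add: finite_A)
  also have "\<dots> = (if h = 0 then discr v else 0)"
  proof (cases "h = 0")
    case False
    then have "\<exists>g\<in>A - {0}. \<sigma> (h + g) v + - v = 0"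
      using h by (intro bexI[of _ "- h"]) (auto simp: minus_in \<sigma>_zero)
    then show ?thesis
      using False finite_A by (simp add: prod_zero_iff del: ab_left_minus add_uminus_conv_diff)
  qed (simp add: discr_def diff_by_def)
  finally show ?thesis .
qed

end

text \<open>In characteristic \<open>p\<close>, every power \<open>q\<close> of \<open>p\<close> qualifies. A module twisted by
  Frobenius is modelled on the same ring, with scalars acting through their \<open>q\<close>-th powers.\<close>

locale frobenius_group_action = finite_group_action A \<sigma>
  for A :: "'g::ab_group_add set" and \<sigma> :: "'g \<Rightarrow> 's::idom \<Rightarrow> 's" +
  fixes q :: nat
  assumes q_pos: "0 < q" and frobenius_add: "(x + y) ^ q = x ^ q + (y :: 's) ^ q"
begin

lemma frobenius_sum: "(sum f I) ^ q = (\<Sum>i\<in>I. (f i :: 's) ^ q)"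
  using q_pos by (induction I rule: infinite_finite_induct) (simp_all add: frobenius_add)

lemma frobenius_diff: "(x - y) ^ q = x ^ q - (y :: 's) ^ q"
  using frobenius_add[of "x - y" y] by simp

text \<open>The adjoint of a group element for the trace form is its inverse. This moves the group
  action from the argument \<open>x\<close> of a homomorphism to its multiplier \<open>c\<close>.\<close>

lemma tr_diff_by:
  assumes a: "a \<in> A"
  shows "tr (c * diff_by a x ^ q) = tr (diff_by (- a) c * x ^ q)"
proof -
  have "tr (c * \<sigma> a x ^ q) = tr (\<sigma> (- a) (c * \<sigma> a x ^ q))"
    using a by (simp add: tr_\<sigma> minus_in)
  also have "\<dots> = tr (\<sigma> (- a) c * x ^ q)"
    by (simp add: \<sigma>_mult \<sigma>_power \<sigma>_comp[symmetric] \<sigma>_zero)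
  finally show ?thesis
    by (simp add: diff_by_def frobenius_diff algebra_simps tr_diff)
qed

text \<open>The factors \<open>a\<^sub>T\<close>, \<open>b\<^sub>T\<close> act as dual bases: \<open>\<Sum>\<^sub>T b\<^sub>T\<^sup>q Tr (D a\<^sub>T\<^sup>q) = D \<delta>\<^sub>v\<^sup>q\<close>.\<close>

lemma trace_nondegenerate:
  assumes zero: "\<And>s. tr (D * s ^ q) = 0" and v: "discr v \<noteq> 0"
  shows "D = 0"
proof -
  let ?P = "Pow (A - {0})"
  have "0 = (\<Sum>T\<in>?P. right_factor v T ^ q * tr (D * left_factor v T ^ q))"
    by (simp add: zero)
  also have "\<dots> = (\<Sum>T\<in>?P. \<Sum>h\<in>A. \<sigma> h D * (\<sigma> h (left_factor v T) * right_factor v T) ^ q)"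
    by (simp add: tr_def sum_distrib_left \<sigma>_mult \<sigma>_power power_mult_distrib mult_ac)
  also have "\<dots> = (\<Sum>h\<in>A. \<sigma> h D * (\<Sum>T\<in>?P. \<sigma> h (left_factor v T) * right_factor v T) ^ q)"
    by (subst sum.swap) (simp add: sum_distrib_left frobenius_sum)
  also have "\<dots> = (\<Sum>h\<in>A. if h = 0 then D * discr v ^ q else 0)"
    using q_pos by (intro sum.cong) (auto simp: factors_orthogonal \<sigma>_zero)
  also have "\<dots> = D * discr v ^ q"
    using finite_A zero_in by simp
  finally show ?thesis using v by simp
qed

definition semilinear :: "('s \<Rightarrow> 's) \<Rightarrow> bool" where
  "semilinear f \<longleftrightarrow> (\<forall>x y. f (x + y) = f x + f y) \<and>
     (\<forall>r x. invariant r \<longrightarrow> f (r * x) = r ^ q * f x) \<and> (\<forall>x. invariant (f x))"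

text \<open>If \<open>f x = Tr (c x\<^sup>q)\<close>, this is \<open>c \<delta>\<^sub>v\<^sup>q\<close>; it makes sense before \<open>c\<close> is known to exist.\<close>

definition scaled_multiplier :: "'s \<Rightarrow> ('s \<Rightarrow> 's) \<Rightarrow> 's" where
  "scaled_multiplier v f = (\<Sum>T\<in>Pow (A - {0}). left_factor v T ^ q * f (right_factor v T))"

lemma semilinear_sum:
  assumes "semilinear f"
  shows "f (sum g I) = (\<Sum>i\<in>I. f (g i))"
proof -
  have add: "f (x + y) = f x + f y" for x y
    using assms by (simp add: semilinear_def)
  have "f 0 = 0" using add[of 0 0] by (simp only: add_0 add_cancel_right_right)
  then show ?thesis
    by (induction I rule: infinite_finite_induct) (simp_all add: add)
qed

text \<open>Because \<open>f\<close> has invariant values and is semilinear over the invariants, it can be pulled out of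
  the trace: the left side is \<open>f (\<Sum>\<^sub>T Tr (a\<^sub>T s) b\<^sub>T)\<close>, and orthogonality leaves only the summand of the
  identity.\<close>

lemma tr_scaled_multiplier:
  assumes f: "semilinear f"
  shows "tr (scaled_multiplier v f * s ^ q) = f (discr v * s)"
proof -
  let ?P = "Pow (A - {0})"
  let ?l = "left_factor v" and ?r = "right_factor v"
  have inv: "\<sigma> h (f x) = f x" if "h \<in> A" for h x
    using f that by (simp add: semilinear_def invariant_def)
  have "tr (scaled_multiplier v f * s ^ q) = (\<Sum>h\<in>A. \<Sum>T\<in>?P. \<sigma> h (?l T * s) ^ q * f (?r T))"
    unfolding tr_def scaled_multiplier_def
    by (intro sum.cong) (simp_all add: \<sigma>_mult \<sigma>_sum \<sigma>_power sum_distrib_left inv power_mult_distrib mult_ac)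
  also have "\<dots> = (\<Sum>T\<in>?P. tr (?l T * s) ^ q * f (?r T))"
    by (subst sum.swap) (simp add: tr_def sum_distrib_right frobenius_sum)
  also have "\<dots> = (\<Sum>T\<in>?P. f (tr (?l T * s) * ?r T))"
    using f by (simp add: semilinear_def invariant_tr)
  also have "\<dots> = f (\<Sum>T\<in>?P. tr (?l T * s) * ?r T)"
    by (rule semilinear_sum[OF f, symmetric])
  also have "(\<Sum>T\<in>?P. tr (?l T * s) * ?r T) = (\<Sum>T\<in>?P. \<Sum>h\<in>A. \<sigma> h s * (\<sigma> h (?l T) * ?r T))"
    by (simp add: tr_def sum_distrib_left \<sigma>_mult mult_ac)
  also have "\<dots> = (\<Sum>h\<in>A. \<sigma> h s * (\<Sum>T\<in>?P. \<sigma> h (?l T) * ?r T))"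
    by (subst sum.swap) (simp add: sum_distrib_left)
  also have "\<dots> = (\<Sum>h\<in>A. if h = 0 then discr v * s else 0)"
    by (intro sum.cong) (auto simp: factors_orthogonal \<sigma>_zero mult.commute[of s])
  also have "\<dots> = discr v * s"
    using finite_A zero_in by simp
  finally show ?thesis .
qed

text \<open>Both sides represent the functional \<open>x \<mapsto> f (\<delta>\<^sub>v \<delta>\<^sub>w x)\<close> for the trace form.\<close>

lemma scaled_multiplier_commute:
  assumes f: "semilinear f" and v: "discr v \<noteq> 0"
  shows "scaled_multiplier v f * discr w ^ q = scaled_multiplier w f * discr v ^ q"
proof -
  have "tr ((scaled_multiplier v f * discr w ^ q - scaled_multiplier w f * discr v ^ q) * s ^ q) = 0" for s
    using tr_scaled_multiplier[OF f, of v "discr w * s"] tr_scaled_multiplier[OF f, of w "discr v * s"]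
    by (simp add: tr_diff power_mult_distrib algebra_simps)
  from trace_nondegenerate[OF this v] show ?thesis by simp
qed

text \<open>A multiplier \<open>c\<close> exists a priori only as the fraction \<open>C\<^sub>v / \<delta>\<^sub>v\<^sup>q\<close>, where \<open>C\<^sub>v\<close> is the scaled
  multiplier. The same fraction has the denominator \<open>\<delta>\<^sub>w\<^sup>q\<close>; since the only prime factor \<open>z\<close> of
  \<open>\<delta>\<^sub>v\<close> does not divide \<open>\<delta>\<^sub>w\<close>, the fraction lies in the ring.\<close>

lemma semilinear_is_trace:
  assumes f: "semilinear f" and z: "prime_elem z"
    and v: "discr v = u * z ^ n" "u dvd 1" "invariant (discr v)" and w: "\<not> z dvd discr w"
  obtains c where "scaled_multiplier v f = c * discr v ^ q" "\<And>x. f x = tr (c * x ^ q)"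
proof -
  have v0: "discr v \<noteq> 0"
    using v(1,2) z by (auto simp: prime_elem_def)
  have "(z ^ n) ^ q dvd scaled_multiplier v f * discr w ^ q"
    unfolding scaled_multiplier_commute[OF f v0] v(1) by (simp add: power_mult_distrib)
  moreover have "\<not> z dvd discr w ^ q"
    using w z prime_elem_dvd_power by blast
  ultimately have "(z ^ n) ^ q dvd scaled_multiplier v f"
    using prime_elem_power_dvd_multD[OF z, of "n * q", unfolded power_mult] by blast
  moreover have "u ^ q dvd 1"
    using v(2) dvd_power_same[of u 1 q] by simp
  ultimately have "discr v ^ q dvd scaled_multiplier v f"
    unfolding v(1) power_mult_distrib
    using mult_dvd_mono[of "u ^ q" 1 "(z ^ n) ^ q" "scaled_multiplier v f"] by simp
  then obtain c where c: "scaled_multiplier v f = c * discr v ^ q"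
    by (metis dvdE mult.commute)
  have inv: "invariant (discr v ^ q)"
    using v(3) by (simp add: invariant_def \<sigma>_power)
  have "f x = tr (c * x ^ q)" for x
  proof -
    have "discr v ^ q * tr (c * x ^ q) = tr (scaled_multiplier v f * x ^ q)"
      by (simp add: c tr_invariant_mult[OF inv, symmetric] mult_ac)
    also have "\<dots> = discr v ^ q * f x"
      using f v(3) by (simp add: tr_scaled_multiplier semilinear_def)
    finally show ?thesis using v0 by simp
  qed
  with c show thesis by (rule that)
qed

end

section \<open>Graded homomorphisms out of the polynomial ring\<close>

text \<open>The degree \<open>d\<close> piece \<open>H\<^sub>d(M)\<close> of \<open>Hom\<^sub>R(S, M)\<close>, for the polynomial ring \<open>S\<close> and \<open>R = S\<^sup>G\<close>.\<close>

definition graded_homs :: "('k::field^'n^'n) set \<Rightarrow> (('n::finite, 'k) mpoly, 'm) graded_module \<Rightarrow> rat \<Rightarrow>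
    (('n, 'k) mpoly \<Rightarrow> 'm) set" where
  "graded_homs G M d = {f. (\<forall>x. f x \<in> carrier M) \<and>
     (\<forall>x y. f (x + y) = f x \<oplus>\<^bsub>M\<^esub> f y) \<and>
     (\<forall>r\<in>carrier (invariant_ring G). \<forall>x. f (r * x) = r \<odot>\<^bsub>M\<^esub> f x) \<and>
     (\<forall>n x. homogeneous n x \<longrightarrow> f x \<in> mod_part M (of_nat n + d))}"

text \<open>All that is needed about \<open>H\<^sub>d(M)\<close> is which pairs of polynomials its elements distinguish.
  In this form the additivity in \<open>M\<close> becomes a plain disjunction over the summands, and the actions
  of \<open>G\<close> and \<open>k\<close> on \<open>H\<^sub>d(M)\<close> need no separate treatment, as they are precompositions.\<close>

definition separates :: "('k::field^'n^'n) set \<Rightarrow> (('n::finite, 'k) mpoly, 'm) graded_module \<Rightarrow> rat \<Rightarrow>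
    ('n, 'k) mpoly \<Rightarrow> ('n, 'k) mpoly \<Rightarrow> bool" where
  "separates G M d x y \<longleftrightarrow> (\<exists>f\<in>graded_homs G M d. f x \<noteq> f y)"

lemma graded_homsI:
  assumes "\<And>x. f x \<in> carrier M" "\<And>x y. f (x + y) = f x \<oplus>\<^bsub>M\<^esub> f y"
    "\<And>r x. r \<in> carrier (invariant_ring G) \<Longrightarrow> f (r * x) = r \<odot>\<^bsub>M\<^esub> f x"
    "\<And>n x. homogeneous n x \<Longrightarrow> f x \<in> mod_part M (of_nat n + d)"
  shows "f \<in> graded_homs G M d"
  using assms by (simp add: graded_homs_def)

lemma graded_homsD:
  assumes "f \<in> graded_homs G M d"
  shows "f x \<in> carrier M" "f (x + y) = f x \<oplus>\<^bsub>M\<^esub> f y"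
    "r \<in> carrier (invariant_ring G) \<Longrightarrow> f (r * x) = r \<odot>\<^bsub>M\<^esub> f x"
    "homogeneous n x \<Longrightarrow> f x \<in> mod_part M (of_nat n + d)"
  using assms by (simp_all add: graded_homs_def)

lemma separatesI: "f \<in> graded_homs G M d \<Longrightarrow> f x \<noteq> f y \<Longrightarrow> separates G M d x y"
  by (auto simp: separates_def)

lemma separatesE:
  assumes "separates G M d x y"
  obtains f where "f \<in> graded_homs G M d" "f x \<noteq> f y"
  using assms by (auto simp: separates_def)

lemma separates_shift: "separates G (shift M a) d x y \<longleftrightarrow> separates G M (a + d) x y"
  by (simp add: separates_def graded_homs_def shift_def add.left_commute)

text \<open>The closure conditions are imposed on \<open>M\<close> only: they let the inverse of the isomorphism
  inherit linearity.\<close>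

lemma separates_cong:
  assumes iso: "graded_iso (invariant_ring G) M N"
    and closed: "\<And>x y. x \<in> carrier M \<Longrightarrow> y \<in> carrier M \<Longrightarrow> x \<oplus>\<^bsub>M\<^esub> y \<in> carrier M"
      "\<And>r x. r \<in> carrier (invariant_ring G) \<Longrightarrow> x \<in> carrier M \<Longrightarrow> r \<odot>\<^bsub>M\<^esub> x \<in> carrier M"
      "\<And>q. mod_part M q \<subseteq> carrier M"
  shows "separates G M d x y \<longleftrightarrow> separates G N d x y"
proof -
  obtain h where h': "bij_betw h (carrier M) (carrier N) \<and>
      (\<forall>x\<in>carrier M. \<forall>y\<in>carrier M. h (x \<oplus>\<^bsub>M\<^esub> y) = h x \<oplus>\<^bsub>N\<^esub> h y) \<and>
      (\<forall>r\<in>carrier (invariant_ring G). \<forall>x\<in>carrier M. h (r \<odot>\<^bsub>M\<^esub> x) = r \<odot>\<^bsub>N\<^esub> h x) \<and>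
      (\<forall>q. h ` mod_part M q = mod_part N q)"
    using iso unfolding graded_iso_def by (rule exE)
  then have bij: "bij_betw h (carrier M) (carrier N)"
    and h: "\<And>x y. x \<in> carrier M \<Longrightarrow> y \<in> carrier M \<Longrightarrow> h (x \<oplus>\<^bsub>M\<^esub> y) = h x \<oplus>\<^bsub>N\<^esub> h y"
      "\<And>r x. r \<in> carrier (invariant_ring G) \<Longrightarrow> x \<in> carrier M \<Longrightarrow> h (r \<odot>\<^bsub>M\<^esub> x) = r \<odot>\<^bsub>N\<^esub> h x"
    and part: "\<And>q. mod_part N q = h ` mod_part M q"
    by simp_all
  let ?k = "inv_into (carrier M) h"
  have inj: "inj_on h (carrier M)" and hM: "h ` carrier M = carrier N"
    using bij by (simp_all add: bij_betw_def)
  have kh: "?k (h x) = x" if "x \<in> carrier M" for x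
    using inj that by simp
  have hk: "h (?k z) = z" and k: "?k z \<in> carrier M" if "z \<in> carrier N" for z
    using that hM by (auto simp: f_inv_into_f inv_into_into)
  show ?thesis
  proof
    assume "separates G M d x y"
    then obtain f where f: "f \<in> graded_homs G M d" "f x \<noteq> f y"
      by (rule separatesE)
    note f' = graded_homsD[OF f(1)]
    have "(\<lambda>x. h (f x)) \<in> graded_homs G N d"
    proof (rule graded_homsI)
      show "h (f (r * x)) = r \<odot>\<^bsub>N\<^esub> h (f x)" if "r \<in> carrier (invariant_ring G)" for r x
        using that by (simp add: f'(1,3) h)
      show "h (f x) \<in> mod_part N (of_nat n + d)" if "homogeneous n x" for n x
        using f'(4)[OF that] part by blast
    qed (use hM f'(1) in \<open>auto simp: f'(2) h(1)\<close>)
    moreover have "h (f x) \<noteq> h (f y)"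
      using f(2) f'(1) inj by (auto dest: inj_onD)
    ultimately show "separates G N d x y"
      by (rule separatesI)
  next
    assume "separates G N d x y"
    then obtain f where f: "f \<in> graded_homs G N d" "f x \<noteq> f y"
      by (rule separatesE)
    note f' = graded_homsD[OF f(1)]
    have "(\<lambda>x. ?k (f x)) \<in> graded_homs G M d"
    proof (rule graded_homsI)
      show "?k (f x) \<in> carrier M" for x using f' k by blast
      show "?k (f (x + y)) = ?k (f x) \<oplus>\<^bsub>M\<^esub> ?k (f y)" for x y
        using kh[of "?k (f x) \<oplus>\<^bsub>M\<^esub> ?k (f y)"] by (simp add: f'(1,2) h hk k closed)
      show "?k (f (r * x)) = r \<odot>\<^bsub>M\<^esub> ?k (f x)" if "r \<in> carrier (invariant_ring G)" for r x
        using kh[of "r \<odot>\<^bsub>M\<^esub> ?k (f x)"] that by (simp add: f'(1,3) h hk k closed)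
      show "?k (f x) \<in> mod_part M (of_nat n + d)" if x: "homogeneous n x" for n x
      proof -
        obtain m where m: "m \<in> mod_part M (of_nat n + d)" "f x = h m"
          using f'(4)[OF x] part by blast
        with closed(3) have "m \<in> carrier M" by blast
        with m show ?thesis by (simp add: kh)
      qed
    qed
    moreover have "?k (f x) \<noteq> ?k (f y)"
      using f(2) hk[OF f'(1)] by metis
    ultimately show "separates G M d x y"
      by (rule separatesI)
  qed
qed

text \<open>A homomorphism into the sum is distinguished by one of its components; conversely, the inclusion
  of a summand needs only that zero is a homogeneous element of every degree in the other summands.
  Shifts of graded modules provide this.\<close>

lemma separates_direct_sum:
  assumes mods: "\<And>i. i < length Ns \<Longrightarrow> \<exists>M a. graded_module (invariant_ring G) M \<and> Ns ! i = shift M a"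
  shows "separates G (direct_sum Ns) d x y \<longleftrightarrow> (\<exists>i<length Ns. separates G (Ns ! i) d x y)"
proof
  assume "separates G (direct_sum Ns) d x y"
  then obtain f where f: "f \<in> graded_homs G (direct_sum Ns) d" "f x \<noteq> f y"
    by (rule separatesE)
  note f' = graded_homsD[OF f(1)]
  have "f z \<in> (\<Pi>\<^sub>E i\<in>{..<length Ns}. carrier (Ns ! i))" for z
    using f'(1) by (simp add: direct_sum_def)
  with f(2) obtain i where i: "i < length Ns" "f x i \<noteq> f y i"
    by (metis PiE_ext lessThan_iff)
  have "(\<lambda>x. f x i) \<in> graded_homs G (Ns ! i) d"
  proof (rule graded_homsI)
    show "f x i \<in> carrier (Ns ! i)" for x
      using f'(1)[of x] i(1) by (auto simp: direct_sum_def)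
    show "f (x + y) i = f x i \<oplus>\<^bsub>Ns ! i\<^esub> f y i" for x y
      using f'(2)[of x y] i(1) by (simp add: direct_sum_def)
    show "f (r * x) i = r \<odot>\<^bsub>Ns ! i\<^esub> f x i" if "r \<in> carrier (invariant_ring G)" for r x
      using f'(3)[OF that, of x] i(1) by (simp add: direct_sum_def)
    show "f x i \<in> mod_part (Ns ! i) (of_nat n + d)" if "homogeneous n x" for n x
      using f'(4)[OF that] i(1) by (auto simp: direct_sum_def)
  qed
  from separatesI[OF this i(2)] i(1) show "\<exists>i<length Ns. separates G (Ns ! i) d x y"
    by blast
next
  assume "\<exists>i<length Ns. separates G (Ns ! i) d x y"
  then obtain i where i: "i < length Ns" "separates G (Ns ! i) d x y"
    by blast
  from i(2) obtain f where f: "f \<in> graded_homs G (Ns ! i) d" "f x \<noteq> f y"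
    by (rule separatesE)
  note f' = graded_homsD[OF f(1)]
  let ?\<iota> = "\<lambda>x. \<lambda>j\<in>{..<length Ns}. if j = i then f x else \<zero>\<^bsub>Ns ! j\<^esub>"
  have zero: "\<zero>\<^bsub>Ns ! j\<^esub> \<in> carrier (Ns ! j)" "\<zero>\<^bsub>Ns ! j\<^esub> \<oplus>\<^bsub>Ns ! j\<^esub> \<zero>\<^bsub>Ns ! j\<^esub> = \<zero>\<^bsub>Ns ! j\<^esub>"
    "\<zero>\<^bsub>Ns ! j\<^esub> \<in> mod_part (Ns ! j) q"
    "r \<in> carrier (invariant_ring G) \<Longrightarrow> r \<odot>\<^bsub>Ns ! j\<^esub> \<zero>\<^bsub>Ns ! j\<^esub> = \<zero>\<^bsub>Ns ! j\<^esub>"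
    if j: "j < length Ns" for j q r
  proof -
    obtain M a where M: "graded_module (invariant_ring G) M" "Ns ! j = shift M a"
      using mods[OF j] by blast
    interpret graded_module "invariant_ring G" M by (rule M(1))
    show "\<zero>\<^bsub>Ns ! j\<^esub> \<in> carrier (Ns ! j)" "\<zero>\<^bsub>Ns ! j\<^esub> \<oplus>\<^bsub>Ns ! j\<^esub> \<zero>\<^bsub>Ns ! j\<^esub> = \<zero>\<^bsub>Ns ! j\<^esub>"
      "r \<in> carrier (invariant_ring G) \<Longrightarrow> r \<odot>\<^bsub>Ns ! j\<^esub> \<zero>\<^bsub>Ns ! j\<^esub> = \<zero>\<^bsub>Ns ! j\<^esub>"
      by (simp_all add: M(2) shift_def)
    show "\<zero>\<^bsub>Ns ! j\<^esub> \<in> mod_part (Ns ! j) q"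
      using additive_subgroup.zero_closed[OF part_additive_subgroup] by (simp add: M(2) shift_def)
  qed
  have "?\<iota> \<in> graded_homs G (direct_sum Ns) d"
    by (rule graded_homsI) (auto simp: direct_sum_def fun_eq_iff PiE_iff f' zero)
  moreover have "?\<iota> x \<noteq> ?\<iota> y"
    using f(2) i(1) by (auto dest: fun_cong[of _ _ i])
  ultimately show "separates G (direct_sum Ns) d x y"
    by (rule separatesI)
qed

section \<open>Polynomials under linear substitutions\<close>

lemma linear_form_axis:
  "linear_form (axis j 1 :: 'k::field^'n) = Poly_Mapping.single (Poly_Mapping.single j 1) 1"
  by (subst linear_form_def, subst sum.mono_neutral_right[of _ "{j}"]) (auto simp: axis_def)

lemma linear_form_0: "linear_form 0 = 0"
  by (simp add: linear_form_def)

lemma linear_form_diff: "linear_form (v - w) = linear_form v - linear_form w"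
  by (simp add: linear_form_def single_diff sum_subtractf)

lemma linear_form_scale: "linear_form (c *s v) = Poly_Mapping.single 0 c * linear_form v"
  by (simp add: linear_form_def sum_distrib_left mult_single)

lemma lookup_linear_form:
  fixes v :: "'k::field^'n"
  shows "Poly_Mapping.lookup (linear_form v) (Poly_Mapping.single j 1) = v $ j"
proof -
  have "Poly_Mapping.single i 1 = Poly_Mapping.single j (1::nat) \<longleftrightarrow> i = j" for i j :: 'n
    by (metis lookup_single_eq lookup_single_not_eq one_neq_zero)
  then show ?thesis
    by (simp add: linear_form_def lookup_sum lookup_single when_def)
qed

lemma linear_form_eq_0_iff: "linear_form v = 0 \<longleftrightarrow> v = 0"
  by (metis linear_form_0 lookup_linear_form lookup_zero vec_eq_iff zero_index)

lemma act_1: "act M 1 = 1"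
  using act_const[of M 1] by simp

lemma act_power: "act M (f ^ n) = act M f ^ n"
  by (induction n) (simp_all add: act_1 act_mult)

lemma act_prod: "act M (prod f I) = (\<Prod>i\<in>I. act M (f i))"
  by (induction I rule: infinite_finite_induct) (simp_all add: act_1 act_mult)

text \<open>Both sides are algebra homomorphisms that send the variables to the same linear forms.\<close>

lemma act_compose: "act (M ** N) f = act M (act N f)"
  unfolding act_def[of N f] act_sum act_mult act_const act_prod act_power act_linear_form
  by (simp add: act_def matrix_vector_mul_assoc)

lemma monomial_as_prod:
  fixes m :: "'n::finite \<Rightarrow>\<^sub>0 nat"
  shows "(\<Prod>j\<in>UNIV. linear_form (axis j (1::'k::field)) ^ Poly_Mapping.lookup m j) = Poly_Mapping.single m 1"
proof -
  have 1: "Poly_Mapping.single (Poly_Mapping.single j 1) (1::'k) ^ k = Poly_Mapping.single (Poly_Mapping.single j k) 1"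
    for j :: 'n and k :: nat
    by (induction k) (simp_all add: mult_single single_add[symmetric])
  have 2: "(\<Prod>j\<in>I. Poly_Mapping.single (g j) (1::'k)) = Poly_Mapping.single (\<Sum>j\<in>I. g j) 1"
    if "finite I" for I :: "'n set" and g :: "'n \<Rightarrow> 'n \<Rightarrow>\<^sub>0 nat"
    using that by (induction I) (simp_all add: mult_single)
  have "(\<Sum>j\<in>UNIV. Poly_Mapping.single j (Poly_Mapping.lookup m j)) = m"
    by (rule poly_mapping_eqI) (simp add: lookup_sum lookup_single when_def)
  then show ?thesis
    by (simp only: linear_form_axis 1 2[OF finite])
qed

lemma act_mat_1: "act (mat 1) f = f"
  by (subst (2) poly_as_sum)
    (simp add: act_def monomial_as_prod mult_single)

text \<open>A singular matrix still acts by an algebra endomorphism; this one substitutes \<open>0\<close> for a variable.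
  Its kernel is the ideal of that variable, so that divisibility by the variable becomes a
  question about a ring homomorphism.\<close>

definition kill_variable :: "'n::finite \<Rightarrow> 'k::field^'n^'n" where
  "kill_variable i = (\<chi> a b. if a = b \<and> a \<noteq> i then 1 else 0)"

lemma kill_variable_mult: "kill_variable i *v v = (\<chi> a. if a = i then 0 else v $ a)"
  by (simp add: kill_variable_def matrix_vector_mult_def vec_eq_iff if_distrib[of "\<lambda>x. x * _"] cong: if_cong)

lemma kill_variable_axis: "kill_variable i *v axis j 1 = (if j = i then 0 else axis j 1)"
  by (simp add: kill_variable_mult vec_eq_iff axis_def)

lemma act_kill_variable_monomial:
  fixes c :: "'k::field"
  shows "act (kill_variable i) (Poly_Mapping.single m c) =
    (if Poly_Mapping.lookup m i = 0 then Poly_Mapping.single m c else 0)"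
proof (cases "Poly_Mapping.lookup m i = 0")
  case True
  have "(\<Prod>j\<in>UNIV. linear_form (kill_variable i *v axis j (1::'k)) ^ Poly_Mapping.lookup m j) =
      (\<Prod>j\<in>UNIV. linear_form (axis j 1) ^ Poly_Mapping.lookup m j)"
    using True by (intro prod.cong) (auto simp: kill_variable_axis)
  then show ?thesis
    using True by (simp add: act_single monomial_as_prod mult_single)
next
  case False
  then have "(\<Prod>j\<in>UNIV. linear_form (kill_variable i *v axis j (1::'k)) ^ Poly_Mapping.lookup m j) = 0"
    by (intro prod_zero) (auto intro!: exI[of _ i] simp: kill_variable_axis linear_form_0 zero_power)
  then show ?thesis
    using False by (simp add: act_single)
qed

lemma variable_dvd_iff:
  "linear_form (axis i 1) dvd f \<longleftrightarrow> act (kill_variable i) f = 0"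
proof
  assume "linear_form (axis i 1) dvd f"
  then show "act (kill_variable i) f = 0"
    by (auto simp: act_mult act_linear_form kill_variable_axis linear_form_0)
next
  assume *: "act (kill_variable i) f = 0"
  define g where "g m = Poly_Mapping.single m (Poly_Mapping.lookup f m)" for m
  let ?K = "Poly_Mapping.keys f"
  have "(\<Sum>m\<in>?K. if Poly_Mapping.lookup m i = 0 then g m else 0) = act (kill_variable i) f"
    by (subst (2) poly_as_sum) (simp only: act_sum act_kill_variable_monomial g_def)
  then have "(\<Sum>m\<in>?K. g m) = (\<Sum>m\<in>?K. if Poly_Mapping.lookup m i = 0 then 0 else g m)"
    unfolding * by (simp add: sum.If_cases sum.Int_Diff[of ?K _ "{m. Poly_Mapping.lookup m i = 0}"] Collect_neg_eq Diff_eq Int_commute)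
  then have f: "f = (\<Sum>m\<in>?K. if Poly_Mapping.lookup m i = 0 then 0 else g m)"
    unfolding g_def using poly_as_sum[of f] by simp
  have "linear_form (axis i 1) dvd g m" if "Poly_Mapping.lookup m i \<noteq> 0" for m
  proof -
    have "m = Poly_Mapping.single i 1 + (m - Poly_Mapping.single i 1)"
      using that by (intro poly_mapping_eqI) (auto simp: lookup_add lookup_minus lookup_single when_def)
    then have "g m = linear_form (axis i 1) * Poly_Mapping.single (m - Poly_Mapping.single i 1) (Poly_Mapping.lookup f m)"
      by (simp add: g_def linear_form_axis mult_single)
    then show ?thesis by simp
  qed
  then show "linear_form (axis i 1) dvd f"
    by (subst f) (auto intro!: dvd_sum)
qed

lemma prime_elem_variable:
  "prime_elem (linear_form (axis i 1) :: ('n::{finite, linorder}, 'k::field) mpoly)"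
  unfolding prime_elem_def variable_dvd_iff
  by (auto simp: act_1 act_mult linear_form_eq_0_iff axis_eq_0_iff)

abbreviation total_degree :: "('n::finite \<Rightarrow>\<^sub>0 nat) \<Rightarrow> nat" where
  "total_degree m \<equiv> \<Sum>i\<in>UNIV. Poly_Mapping.lookup m i"

lemma homogeneous_0: "homogeneous d 0"
  by (simp add: homogeneous_def)

lemma homogeneous_sum: "(\<And>i. i \<in> I \<Longrightarrow> homogeneous d (f i)) \<Longrightarrow> homogeneous d (sum f I)"
  by (induction I rule: infinite_finite_induct)
    (use keys_add in \<open>fastforce simp: homogeneous_def\<close>)+

lemma homogeneous_minus: "homogeneous d f \<Longrightarrow> homogeneous d (- f)"
  for f :: "('n::finite, 'k::ab_group_add) mpoly"
  by (simp add: homogeneous_def)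

lemma homogeneous_mult:
  assumes "homogeneous d f" "homogeneous e g"
  shows "homogeneous (d + e) (f * g :: ('n::finite, 'k::field) mpoly)"
  unfolding homogeneous_def
proof
  fix m assume "m \<in> Poly_Mapping.keys (f * g)"
  then obtain a b where "a \<in> Poly_Mapping.keys f" "b \<in> Poly_Mapping.keys g" "m = a + b"
    using keys_mult[of f g] by blast
  then show "total_degree m = d + e"
    using assms by (auto simp: homogeneous_def lookup_add sum.distrib)
qed

lemma homogeneous_const: "homogeneous 0 (Poly_Mapping.single 0 c)"
  by (simp add: homogeneous_def)

lemma homogeneous_1: "homogeneous 0 (1 :: ('n::finite, 'k::field) mpoly)"
  by (simp add: homogeneous_def)

lemma homogeneous_linear_form: "homogeneous 1 (linear_form (v :: 'k::field^'n))"
  unfolding linear_form_def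
  by (intro homogeneous_sum) (auto simp: homogeneous_def lookup_single when_def)

lemma homogeneous_power: "homogeneous d f \<Longrightarrow> homogeneous (d * n) (f ^ n :: ('n::finite, 'k::field) mpoly)"
  using homogeneous_1 by (induction n) (auto dest: homogeneous_mult)

lemma homogeneous_prod:
  assumes "\<And>i. i \<in> I \<Longrightarrow> homogeneous d (f i :: ('n::finite, 'k::field) mpoly)" "finite I"
  shows "homogeneous (d * card I) (prod f I)"
  using assms(2,1) homogeneous_1 by (induction I) (auto dest: homogeneous_mult)

lemma homogeneous_act:
  assumes "homogeneous d f"
  shows "homogeneous d (act M f)"
  unfolding act_def
proof (intro homogeneous_sum)
  fix m assume m: "m \<in> Poly_Mapping.keys f"
  have "homogeneous (sum (Poly_Mapping.lookup m) I)
      (\<Prod>j\<in>I. linear_form (M *v axis j 1) ^ Poly_Mapping.lookup m j)" for I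
    using homogeneous_1
    by (induction I rule: infinite_finite_induct)
      (auto intro!: homogeneous_mult homogeneous_power[OF homogeneous_linear_form, simplified])
  from homogeneous_mult[OF homogeneous_const this[of UNIV]] m assms
  show "homogeneous d (Poly_Mapping.single 0 (Poly_Mapping.lookup f m) *
      (\<Prod>j\<in>UNIV. linear_form (M *v axis j 1) ^ Poly_Mapping.lookup m j))"
    by (simp add: homogeneous_def)
qed

text \<open>Multiplication by a monomial shifts exponents injectively, so no cancellation can hide a term
  of \<open>c\<close> of the wrong degree.\<close>

lemma homogeneous_mult_monomial_cancel:
  fixes c :: "('n::finite, 'k::field) mpoly"
  assumes "homogeneous d (c * Poly_Mapping.single m a)" "a \<noteq> 0" "c \<noteq> 0"
  shows "total_degree m \<le> d" "homogeneous (d - total_degree m) c"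
proof -
  have "total_degree k + total_degree m = d" if k: "k \<in> Poly_Mapping.keys c" for k
  proof -
    have "c * Poly_Mapping.single m a =
        (\<Sum>l\<in>Poly_Mapping.keys c. Poly_Mapping.single (l + m) (Poly_Mapping.lookup c l * a))"
      by (subst poly_as_sum[of c]) (simp add: sum_distrib_right mult_single)
    then have "Poly_Mapping.lookup (c * Poly_Mapping.single m a) (k + m) = Poly_Mapping.lookup c k * a"
      using k by (simp add: lookup_sum lookup_single when_def)
    then have "k + m \<in> Poly_Mapping.keys (c * Poly_Mapping.single m a)"
      using k assms(2) by (simp add: in_keys_iff)
    then show ?thesis
      using assms(1) by (auto simp: homogeneous_def lookup_add sum.distrib)
  qed
  moreover obtain k where "k \<in> Poly_Mapping.keys c"
    using assms(3) by fastforce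
  ultimately show "total_degree m \<le> d" "homogeneous (d - total_degree m) c"
    by (force simp: homogeneous_def)+
qed

lemma homogeneous_0_imp_const:
  assumes "homogeneous 0 (f :: ('n::finite, 'k::field) mpoly)"
  obtains a where "f = Poly_Mapping.single 0 a"
proof
  have "Poly_Mapping.keys f \<subseteq> {0}"
    using assms by (auto simp: homogeneous_def intro!: poly_mapping_eqI)
  then show "f = Poly_Mapping.single 0 (Poly_Mapping.lookup f 0)"
    by (intro poly_mapping_eqI) (auto simp: lookup_single when_def in_keys_iff)
qed

lemma homogeneous_1_imp_linear_form:
  assumes "homogeneous 1 (f :: ('n::finite, 'k::field) mpoly)"
  obtains v where "f = linear_form v"
proof
  have keys: "\<exists>i. m = Poly_Mapping.single i 1" if "m \<in> Poly_Mapping.keys f" for m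
  proof -
    have "total_degree m = 1"
      using assms that by (simp add: homogeneous_def)
    then obtain i where "Poly_Mapping.lookup m i = 1" "\<And>j. j \<noteq> i \<Longrightarrow> Poly_Mapping.lookup m j = 0"
      using sum_eq_1_iff[of UNIV "Poly_Mapping.lookup m"] by auto
    then show ?thesis
      by (intro exI[of _ i] poly_mapping_eqI) (auto simp: lookup_single when_def)
  qed
  let ?v = "\<chi> i. Poly_Mapping.lookup f (Poly_Mapping.single i 1)"
  show "f = linear_form ?v"
  proof (rule poly_mapping_eqI)
    fix m
    show "Poly_Mapping.lookup f m = Poly_Mapping.lookup (linear_form ?v) m"
    proof (cases "\<exists>i. m = Poly_Mapping.single i 1")
      case False
      then have "m \<notin> Poly_Mapping.keys f" using keys by blast
      moreover have "Poly_Mapping.lookup (linear_form ?v) m = 0"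
        using False by (auto simp: linear_form_def lookup_sum lookup_single when_def intro!: sum.neutral)
      ultimately show ?thesis by (simp add: in_keys_iff)
    qed (auto simp: lookup_linear_form[unfolded One_nat_def])
  qed
qed

section \<open>A group of order nine\<close>

abbreviation const :: "'k::field \<Rightarrow> ('n::finite, 'k) mpoly" where
  "const \<equiv> Poly_Mapping.single 0"

definition t_K :: K where
  "t_K = to_ac (Fract [:0, 1:] 1)"

lemma t_K_power_inject: "t_K ^ m = t_K ^ n \<longleftrightarrow> m = n"
proof -
  have "Fract p 1 ^ k = Fract (p ^ k) 1" for p :: "3 mod_ring poly" and k
    by (induction k) (simp_all add: One_fract_def)
  moreover have "[:0, 1 :: 3 mod_ring:] ^ k = monom 1 k" for k
    by (simp add: monom_altdef)
  ultimately have "t_K ^ m = t_K ^ n \<longleftrightarrow> monom (1 :: 3 mod_ring) m = monom 1 n"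
    by (simp add: t_K_def eq_fract flip: to_ac_power)
  also have "\<dots> \<longleftrightarrow> m = n"
    by (metis degree_monom_eq zero_neq_one)
  finally show ?thesis .
qed

lemma three_eq_0: "(3 :: K) = 0"
  using of_nat_CHAR[where ?'a = K] unfolding CHAR_K by simp

lemma CHAR_mpoly: "CHAR(('n::finite, 'k::field) mpoly) = CHAR('k)"
proof (rule CHAR_eqI)
  show "of_nat CHAR('k) = (0 :: ('n, 'k) mpoly)"
    by (metis comp_apply of_nat_CHAR of_nat_single single_zero)
next
  fix n assume "of_nat n = (0 :: ('n, 'k) mpoly)"
  moreover have "Poly_Mapping.lookup (of_nat n :: ('n, 'k) mpoly) 0 = of_nat n"
    by (metis comp_apply lookup_single_eq of_nat_single)
  ultimately have "of_nat n = (0 :: 'k)" by simp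
  then show "CHAR('k) dvd n"
    by (simp add: of_nat_eq_0_iff_char_dvd)
qed

definition F3 :: "K set" where "F3 = {0, 1, -1}"

lemma F3_diff:
  assumes "x \<in> F3" "y \<in> F3"
  shows "x - y \<in> F3"
proof -
  have "(1::K) + 1 = -1" "- (1::K) - 1 = 1"
    using three_eq_0 by (simp_all add: eq_neg_iff_add_eq_0 diff_eq_eq minus_equation_iff[of "1::K"])
  then show ?thesis using assms by (auto simp: F3_def)
qed

lemma card_F3: "card F3 = 3"
proof -
  have "(1::K) \<noteq> -1"
  proof
    assume "(1::K) = -1"
    then have "(1::K) + 1 = 0" by (metis add.right_inverse)
    moreover have "(3::K) = (1 + 1) + 1" by simp
    ultimately have "(3::K) = 1" by (simp only: add_0)
    then show False using three_eq_0 by simp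
  qed
  then show ?thesis by (simp add: F3_def)
qed

text \<open>The additive group \<open>\<F> + \<F> t\<close> of exponents.\<close>

definition params :: "K set" where
  "params = (\<lambda>(i, j). i + j * t_K) ` (F3 \<times> F3)"

text \<open>A coincidence \<open>i + j t = i' + j' t\<close> with \<open>j \<noteq> j'\<close> would give \<open>t\<^sup>3 = t\<close>, because cubing
  fixes every element of the prime field.\<close>

lemma card_params: "card params = 9"
proof -
  have "inj_on (\<lambda>(i, j). i + j * t_K) (F3 \<times> F3)"
  proof (rule inj_onI, clarify)
    fix i j i' j' assume F: "i \<in> F3" "j \<in> F3" "i' \<in> F3" "j' \<in> F3"
      and eq: "i + j * t_K = i' + j' * t_K"
    then have *: "(j - j') * t_K = i' - i" by (simp add: algebra_simps)
    have cube: "x ^ 3 = x" if "x \<in> F3" for x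
      using that by (auto simp: F3_def power3_eq_cube)
    have "j = j'"
    proof (rule ccontr)
      assume "j \<noteq> j'"
      have "(j - j') * t_K ^ 3 = ((j - j') * t_K) ^ 3"
        using cube[OF F3_diff[OF F(2,4)]] by (simp add: power_mult_distrib)
      also have "\<dots> = (j - j') * t_K ^ 1"
        using cube[OF F3_diff[OF F(3,1)]] by (simp add: *)
      finally show False
        using \<open>j \<noteq> j'\<close> by (simp only: mult_cancel_left t_K_power_inject) simp
    qed
    with * show "i = i' \<and> j = j'" by simp
  qed
  then show ?thesis
    by (simp add: params_def card_image card_cartesian_product card_F3)
qed

text \<open>This is \<open>exp (a J) = 1 + a J + (a\<^sup>2 / 2) J\<^sup>2\<close>, as \<open>1 / 2 = - 1\<close> in characteristic three.\<close>

definition shear :: "K \<Rightarrow> K^3^3" where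
  "shear a = vector [vector [1, a, - a\<^sup>2], vector [0, 1, a], vector [0, 0, 1]]"

lemma shear_0: "shear 0 = mat 1"
  by (simp add: shear_def mat_def vec_eq_iff forall_3)

lemma shear_mult: "shear a ** shear b = shear (a + b)"
proof -
  have "3 * (a * b) = 0" by (simp add: three_eq_0)
  then have "a * b - a\<^sup>2 - b\<^sup>2 = - (a + b)\<^sup>2"
    by (simp add: power2_eq_square algebra_simps)
  then show ?thesis
    by (simp add: shear_def matrix_matrix_mult_def vec_eq_iff forall_3 sum_3 algebra_simps)
qed

lemma inj_shear: "inj shear"
  by (rule injI) (metis shear_def vector_3(1,2))

lemma shear_diff_vec: "shear a *v v - v = vector [a * v $ 2 - a\<^sup>2 * v $ 3, a * v $ 3, 0]"
  by (simp add: shear_def matrix_vector_mult_def vec_eq_iff forall_3 sum_3)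

lemma group_GL: "group (GL :: ('k::field^'n^'n) monoid)"
proof (rule groupI)
  fix M :: "'k^'n^'n" assume "M \<in> carrier GL"
  then show "\<exists>N\<in>carrier GL. N \<otimes>\<^bsub>GL\<^esub> M = \<one>\<^bsub>GL\<^esub>"
    by (auto simp: GL_def invertible_def)
next
  show "\<one>\<^bsub>GL\<^esub> \<in> carrier (GL :: ('k^'n^'n) monoid)"
    by (auto simp: GL_def invertible_def)
qed (auto simp: GL_def invertible_mult matrix_mul_assoc)

interpretation shear: finite_group_action params "\<lambda>a. act (shear a)"
proof
  show "finite params"
    using card_params by (metis card.infinite zero_neq_numeral)
  show "0 \<in> params" by (auto simp: params_def F3_def image_iff)
  show "a - b \<in> params" if "a \<in> params" "b \<in> params" for a b
  proof -
    from that obtain i j i' j' where *: "i \<in> F3" "j \<in> F3" "i' \<in> F3" "j' \<in> F3"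
      "a = i + j * t_K" "b = i' + j' * t_K" by (auto simp: params_def)
    then have "a - b = (\<lambda>(i, j). i + j * t_K) (i - i', j - j')" by (simp add: algebra_simps)
    then show ?thesis unfolding params_def using * F3_diff by blast
  qed
qed (simp_all add: shear_0 act_mat_1 act_compose act_add act_mult act_1 flip: shear_mult)

lemma frobenius_shear: "frobenius_group_action params (\<lambda>a. act (shear a)) (3 ^ e)"
proof
  have "CHAR((3, K) mpoly) = 3" by (simp only: CHAR_mpoly CHAR_K)
  then show "(x + y) ^ 3 ^ e = x ^ 3 ^ e + y ^ 3 ^ e" for x y :: "(3, K) mpoly"
    by (intro freshmans_dream') simp_all
qed simp

definition shears :: "(K^3^3) set" where
  "shears = shear ` params"

lemma subgroup_shears: "subgroup shears GL"
proof -
  interpret group "GL :: (K^3^3) monoid" by (rule group_GL)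
  have inv: "invertible (shear a)" for a
    unfolding invertible_def
    by (auto intro!: exI[of _ "shear (- a)"] simp: shear_mult shear_0)
  show ?thesis
  proof (rule subgroupI)
    show "shears \<noteq> {}" using shear.zero_in by (auto simp: shears_def)
    fix M assume "M \<in> shears"
    then obtain a where a: "a \<in> params" "M = shear a" by (auto simp: shears_def)
    have "inv\<^bsub>GL\<^esub> M = shear (- a)"
      by (intro inv_equality) (simp_all add: a inv GL_def shear_mult shear_0)
    then show "inv\<^bsub>GL\<^esub> M \<in> shears"
      using a shear.minus_in by (auto simp: shears_def)
  qed (auto simp: shears_def inv GL_def shear_mult shear.add_in)
qed

lemma card_shears: "card shears = 9"
  by (simp add: shears_def card_image inj_on_subset[OF inj_shear] card_params)

abbreviation var :: "3 \<Rightarrow> (3, K) mpoly" where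
  "var i \<equiv> linear_form (axis i 1)"

abbreviation shear_diff :: "K \<Rightarrow> (3, K) mpoly \<Rightarrow> (3, K) mpoly" where
  "shear_diff \<equiv> shear.diff_by"

lemma shear_diff_linear_form:
  "shear_diff a (linear_form v) = linear_form (vector [a * v $ 2 - a\<^sup>2 * v $ 3, a * v $ 3, 0])"
  by (simp add: shear.diff_by_def act_linear_form shear_diff_vec flip: linear_form_diff)

text \<open>On linear forms \<open>J\<^sup>3 = 0\<close>, so the product of two displacements is \<open>a b J\<^sup>2\<close>.\<close>

lemma shear_diff_diff_linear_form:
  "shear_diff b (shear_diff a (linear_form v)) = linear_form (vector [a * b * v $ 3, 0, 0])"
  by (simp add: shear_diff_linear_form mult_ac)

lemma shear_diff_const: "shear_diff a (const c) = 0"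
  by (simp add: shear.diff_by_def act_const)

lemma shear_diff_const_mult: "shear_diff a (const c * x) = const c * shear_diff a x"
  by (simp add: shear.diff_by_def act_mult act_const algebra_simps)

lemma invariant_var_1: "shear.invariant (var 1)"
proof -
  have "vector [0, 0, 0] = (0 :: K^3)" by (simp add: vec_eq_iff forall_3)
  then have "shear_diff a (var 1) = 0" for a
    by (simp add: shear_diff_linear_form axis_def linear_form_0)
  then show ?thesis by (simp add: shear.invariant_def shear.diff_by_def)
qed

text \<open>The shears move \<open>x\<^sub>2\<close> only by multiples of \<open>x\<^sub>1\<close>.\<close>

lemma discr_var_2: "shear.discr (var 2) = const (\<Prod>a\<in>params - {0}. a) * var 1 ^ card (params - {0})"
proof -
  have "(vector [a, 0, 0] :: K^3) = a *s axis 1 1" for a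
    by (simp add: vec_eq_iff forall_3 axis_def)
  then have "shear_diff a (var 2) = const a * var 1" for a
    by (simp add: shear_diff_linear_form axis_def flip: linear_form_scale)
  moreover have "(\<Prod>a\<in>I. const a) = (const (\<Prod>a\<in>I. a) :: (3, K) mpoly)" for I :: "K set"
    by (induction I rule: infinite_finite_induct) (simp_all add: single_0_mult)
  ultimately show ?thesis
    by (simp add: shear.discr_def prod.distrib)
qed

text \<open>Modulo \<open>x\<^sub>1\<close>, the shear with exponent \<open>a \<noteq> 0\<close> moves \<open>x\<^sub>3\<close> by \<open>a x\<^sub>2\<close>. Together with the previous lemma
  this expresses that the shears are not reflections: both \<open>x\<^sub>1\<close> and a form prime to it arise
  as displacements of linear forms.\<close>

lemma var_1_not_dvd_discr_var_3: "\<not> var 1 dvd shear.discr (var 3)"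
proof -
  have "act (kill_variable 1) (shear_diff a (var 3)) \<noteq> 0" if "a \<noteq> 0" for a
    using that by (simp add: shear_diff_linear_form act_linear_form kill_variable_mult
      linear_form_eq_0_iff vec_eq_iff forall_3 axis_def)
  then show ?thesis
    using shear.finite_A by (simp add: variable_dvd_iff shear.discr_def act_prod prod_zero_iff)
qed

abbreviation invariants :: "(3, K) mpoly graded_ring" where
  "invariants \<equiv> invariant_ring shears"

lemma carrier_invariants: "x \<in> carrier invariants \<longleftrightarrow> shear.invariant x"
  by (simp add: invariant_ring_def shear.invariant_def shears_def)

lemma nat_pow_invariants: "x [^]\<^bsub>invariants\<^esub> (n::nat) = x ^ n"
proof -
  interpret cring invariants by (rule cring_invariant_ring)
  show ?thesis
    by (induction n) (simp_all, simp_all add: invariant_ring_def)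
qed

abbreviation frob :: "nat \<Rightarrow> ((3, K) mpoly, (3, K) mpoly) graded_module" where
  "frob e \<equiv> frobenius_module 3 e invariants"

lemma frob_simps:
  "x \<in> carrier (frob e) \<longleftrightarrow> shear.invariant x"
  "x \<oplus>\<^bsub>frob e\<^esub> y = x + y"
  "r \<odot>\<^bsub>frob e\<^esub> x = r ^ 3 ^ e * x"
  by (simp_all add: frobenius_module_def carrier_invariants nat_pow_invariants)
    (simp_all add: invariant_ring_def)

lemma frob_part:
  "x \<in> mod_part (frob e) s \<longleftrightarrow> x = 0 \<or>
    shear.invariant x \<and> (\<exists>m. of_nat m = 3 ^ e * s \<and> homogeneous m x)"
  by (auto simp: frobenius_module_def invariant_ring_def shear.invariant_def shears_def field_simps)


section \<open>Homomorphisms into the Frobenius modules\<close>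

lemma graded_hom_semilinear:
  assumes f: "f \<in> graded_homs shears (frob e) d"
  shows "frobenius_group_action.semilinear params (\<lambda>a. act (shear a)) (3 ^ e) f"
  using graded_homsD(1-3)[OF f]
  by (simp add: frobenius_group_action.semilinear_def[OF frobenius_shear] frob_simps carrier_invariants)

text \<open>The summand of \<open>T\<close> is a \<open>q\<close>-th power of degree \<open>q |T|\<close> times a value of \<open>f\<close> of degree
  \<open>q (N - |T| + d)\<close>, where \<open>N\<close> is the number of nontrivial group elements. The total is independent of \<open>T\<close>;
  if it is not a natural number, all the values vanish.\<close>

lemma homogeneous_scaled_multiplier:
  assumes f: "f \<in> graded_homs shears (frob e) d" and v: "homogeneous 1 v"
  defines "C \<equiv> frobenius_group_action.scaled_multiplier params (\<lambda>a. act (shear a)) (3 ^ e) v f"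
  shows "C = 0 \<or> (\<exists>n. of_nat n = 3 ^ e * (of_nat (card (params - {0})) + d) \<and> homogeneous n C)"
proof -
  interpret frobenius_group_action params "\<lambda>a. act (shear a)" "3 ^ e"
    by (rule frobenius_shear)
  let ?I = "params - {0}"
  have fin: "finite ?I" using shear.finite_A by simp
  have right: "homogeneous (card (?I - T)) (shear.right_factor v T)" for T
    unfolding shear.right_factor_def using homogeneous_prod[of "?I - T" 1 "\<lambda>_. - v"] fin v
    by (simp add: homogeneous_minus)
  have left: "homogeneous (card T) (shear.left_factor v T)" if "T \<subseteq> ?I" for T
    unfolding shear.left_factor_def
    using homogeneous_prod[of T 1 "\<lambda>g. act (shear g) v"] finite_subset[OF that fin] v
    by (simp add: homogeneous_act)
  have f_val: "f (shear.right_factor v T) = 0 \<or>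
      (\<exists>m. of_nat m = 3 ^ e * (of_nat (card (?I - T)) + d) \<and> homogeneous m (f (shear.right_factor v T)))" for T
    using graded_homsD(4)[OF f right] by (auto simp: frob_part)
  have card: "card T + card (?I - T) = card ?I" if "T \<subseteq> ?I" for T
    using that fin by (simp add: card_Diff_subset card_mono finite_subset)
  show ?thesis
  proof (cases "\<exists>n. of_nat n = 3 ^ e * (of_nat (card ?I) + d)")
    case True
    then obtain n where n: "of_nat n = 3 ^ e * (of_nat (card ?I) + d)" by blast
    have "homogeneous n (shear.left_factor v T ^ 3 ^ e * f (shear.right_factor v T))" if T: "T \<subseteq> ?I" for T
      using f_val[of T]
    proof (elim disjE exE conjE)
      fix m assume m: "of_nat m = 3 ^ e * (of_nat (card (?I - T)) + d)"
        and h: "homogeneous m (f (shear.right_factor v T))"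
      have "rat_of_nat (card T * 3 ^ e + m) = of_nat n"
        unfolding n card[OF T, symmetric] by (simp add: m algebra_simps)
      then have "card T * 3 ^ e + m = n" by (simp only: of_nat_eq_iff)
      with homogeneous_mult[OF homogeneous_power[OF left[OF T], of "3 ^ e"] h]
      show ?thesis by simp
    qed (simp add: homogeneous_0)
    then have "homogeneous n C"
      unfolding C_def scaled_multiplier_def by (intro homogeneous_sum) auto
    with n show ?thesis by blast
  next
    case False
    have "f (shear.right_factor v T) = 0" if T: "T \<subseteq> ?I" for T
      using f_val[of T]
    proof (elim disjE exE conjE)
      fix m assume m: "of_nat m = 3 ^ e * (of_nat (card (?I - T)) + d)"
      have "rat_of_nat (card T * 3 ^ e + m) = 3 ^ e * (of_nat (card ?I) + d)"
        unfolding card[OF T, symmetric] by (simp add: m algebra_simps)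
      with False show ?thesis by blast
    qed
    then have "C = 0"
      unfolding C_def scaled_multiplier_def by (intro sum.neutral) auto
    then show ?thesis ..
  qed
qed

text \<open>The multiplier is homogeneous of degree \<open>q d\<close>, since multiplying it by the monomial
  \<open>\<delta>\<^sup>q\<close> with \<open>\<delta>\<close> a multiple of \<open>x\<^sub>1\<^sup>N\<close> gives a form of degree \<open>q (N + d)\<close>.\<close>

lemma graded_hom_is_trace:
  assumes f: "f \<in> graded_homs shears (frob e) d"
  obtains c where "\<And>x. f x = shear.tr (c * x ^ 3 ^ e)"
    "c = 0 \<or> (\<exists>m. of_nat m = 3 ^ e * d \<and> homogeneous m c)"
proof -
  interpret frobenius_group_action params "\<lambda>a. act (shear a)" "3 ^ e"
    by (rule frobenius_shear)
  let ?N = "card (params - {0})" and ?u = "\<Prod>a\<in>params - {0}. a"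
  have u: "?u \<noteq> 0" using shear.finite_A by (simp add: prod_zero_iff)
  have "const ?u * const (inverse ?u) = (1 :: (3, K) mpoly)"
    using u by (simp add: mult_single)
  then have unit: "const ?u dvd (1 :: (3, K) mpoly)" by (metis dvd_triv_left)
  have inv: "shear.invariant (shear.discr (var 2))"
    using invariant_var_1
    by (simp add: discr_var_2 shear.invariant_def act_mult act_const act_power)
  obtain c where c: "scaled_multiplier (var 2) f = c * shear.discr (var 2) ^ 3 ^ e"
      "\<And>x. f x = shear.tr (c * x ^ 3 ^ e)"
    using semilinear_is_trace[OF graded_hom_semilinear[OF f] prime_elem_variable discr_var_2 unit inv
      var_1_not_dvd_discr_var_3] by blast
  let ?m = "Poly_Mapping.single 1 (?N * 3 ^ e) :: 3 \<Rightarrow>\<^sub>0 nat"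
  have var: "var 1 ^ n = Poly_Mapping.single (Poly_Mapping.single 1 n) 1" for n
    by (induction n) (simp_all add: linear_form_axis mult_single flip: single_add)
  have "Poly_Mapping.single (Poly_Mapping.single (1 :: 3) n) (a :: K) ^ k =
      Poly_Mapping.single (Poly_Mapping.single 1 (n * k)) (a ^ k)" for n k a
    by (induction k) (simp_all add: mult_single flip: single_add)
  then have discr: "shear.discr (var 2) ^ 3 ^ e = Poly_Mapping.single ?m (?u ^ 3 ^ e)"
    by (simp add: discr_var_2 var mult_single)
  have deg: "total_degree ?m = ?N * 3 ^ e"
    by (simp add: lookup_single when_def)
  have "c = 0 \<or> (\<exists>m. of_nat m = 3 ^ e * d \<and> homogeneous m c)"
  proof (cases "c = 0")
    case False
    then have "scaled_multiplier (var 2) f \<noteq> 0"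
      using unit by (auto simp: c(1) discr_var_2 linear_form_eq_0_iff axis_eq_0_iff)
    then obtain n where n: "of_nat n = 3 ^ e * (of_nat ?N + d)" "homogeneous n (scaled_multiplier (var 2) f)"
      using homogeneous_scaled_multiplier[OF f homogeneous_linear_form] by blast
    from homogeneous_mult_monomial_cancel[OF n(2)[unfolded c(1) discr] _ False] u
    have "?N * 3 ^ e \<le> n" "homogeneous (n - ?N * 3 ^ e) c"
      unfolding deg by simp_all
    moreover from this(1) have "of_nat (n - ?N * 3 ^ e) = 3 ^ e * d"
      by (simp add: of_nat_diff n(1) algebra_simps)
    ultimately show ?thesis by blast
  qed simp
  with c(2) show thesis by (rule that)
qed


lemma tr_shear_diff_diff:
  assumes "a \<in> params" "b \<in> params"
  shows "shear.tr (c * shear_diff a (shear_diff b x) ^ 3 ^ e) =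
    shear.tr (shear_diff (- b) (shear_diff (- a) c) * x ^ 3 ^ e)"
  using assms by (simp add: frobenius_group_action.tr_diff_by[OF frobenius_shear])

lemma one_in_params: "1 \<in> params"
  by (auto simp: params_def F3_def image_iff)

lemma t_K_in_params: "t_K \<in> params"
  by (auto simp: params_def F3_def image_iff)

text \<open>Here \<open>q d < 1\<close>, so the multiplier is a constant, and group elements fix constants.\<close>

lemma not_separates_low_degree:
  assumes "d < 1 / 3 ^ e"
  shows "\<not> separates shears (frob e) d (shear_diff 1 (shear_diff 1 x)) 0"
proof
  assume "separates shears (frob e) d (shear_diff 1 (shear_diff 1 x)) 0"
  then obtain f where f: "f \<in> graded_homs shears (frob e) d"
      "f (shear_diff 1 (shear_diff 1 x)) \<noteq> f 0"
    by (rule separatesE)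
  obtain c where c: "\<And>x. f x = shear.tr (c * x ^ 3 ^ e)"
    "c = 0 \<or> (\<exists>m. of_nat m = 3 ^ e * d \<and> homogeneous m c)"
    by (rule graded_hom_is_trace[OF f(1)]) blast
  have "homogeneous 0 c"
    using c(2)
  proof (elim disjE exE conjE)
    fix m assume m: "of_nat m = 3 ^ e * d" and h: "homogeneous m c"
    have "3 ^ e * d < 1" using assms by (simp add: field_simps)
    then have "m = 0" using m[symmetric] by simp
    with h show ?thesis by simp
  qed (simp add: homogeneous_0)
  then obtain a where "c = const a" by (rule homogeneous_0_imp_const)
  then have "f (shear_diff 1 (shear_diff 1 x)) = f 0"
    by (simp add: c(1) tr_shear_diff_diff one_in_params shear_diff_const shear.diff_by_0 shear.tr_0 zero_power)
  with f(2) show False ..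
qed

text \<open>The homomorphism with multiplier \<open>x\<^sub>3\<close> works: \<open>(g - 1)\<^sup>2 x\<^sub>3 \<noteq> 0\<close> for \<open>g = exp (- J)\<close>, and the trace form
  is nondegenerate.\<close>

lemma separates_linear_degree:
  "\<exists>x. separates shears (frob e) (1 / 3 ^ e) (shear_diff 1 (shear_diff 1 x)) 0"
proof -
  interpret frobenius_group_action params "\<lambda>a. act (shear a)" "3 ^ e"
    by (rule frobenius_shear)
  let ?f = "\<lambda>x. shear.tr (var 3 * x ^ 3 ^ e)"
  have inv_power: "shear.invariant (r ^ n)" if "shear.invariant r" for r n
    using that by (simp add: shear.invariant_def act_power)
  have f: "?f \<in> graded_homs shears (frob e) (1 / 3 ^ e)"
  proof (rule graded_homsI)
    show "?f x \<in> carrier (frob e)" for x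
      by (simp add: frob_simps shear.invariant_tr)
    show "?f (x + y) = ?f x \<oplus>\<^bsub>frob e\<^esub> ?f y" for x y
      by (simp add: frob_simps frobenius_add distrib_left shear.tr_add)
    show "?f (r * x) = r \<odot>\<^bsub>frob e\<^esub> ?f x" if "r \<in> carrier invariants" for r x
      using that shear.tr_invariant_mult[OF inv_power, of r "3 ^ e" "var 3 * x ^ 3 ^ e"]
      by (simp add: frob_simps carrier_invariants power_mult_distrib mult_ac)
    show "?f x \<in> mod_part (frob e) (of_nat n + 1 / 3 ^ e)" if x: "homogeneous n x" for n x
    proof -
      have "homogeneous (1 + n * 3 ^ e) (?f x)"
        unfolding shear.tr_def
        by (intro homogeneous_sum homogeneous_act homogeneous_mult homogeneous_linear_form homogeneous_power x)
      moreover have "rat_of_nat (1 + n * 3 ^ e) = 3 ^ e * (of_nat n + 1 / 3 ^ e)"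
        by (simp add: distrib_left mult.commute)
      ultimately show ?thesis
        by (simp only: frob_part shear.invariant_tr) blast
    qed
  qed
  define c where "c = shear_diff (- 1) (shear_diff (- 1) (var 3))"
  have "c \<noteq> 0"
    by (simp add: c_def shear_diff_diff_linear_form linear_form_eq_0_iff vec_eq_iff forall_3 axis_def)
  have discr: "shear.discr (var 3) \<noteq> 0"
    using var_1_not_dvd_discr_var_3 by auto
  obtain x where "shear.tr (c * x ^ 3 ^ e) \<noteq> 0"
    using trace_nondegenerate[OF _ discr, of c] \<open>c \<noteq> 0\<close> by blast
  then have "?f (shear_diff 1 (shear_diff 1 x)) \<noteq> ?f 0"
    by (simp add: tr_shear_diff_diff one_in_params c_def shear.tr_0 zero_power)
  from separatesI[OF f this] show ?thesis by blast
qed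

text \<open>Multipliers of degree \<open>1\<close> are linear forms \<open>c\<close>. The argument on the left contributes \<open>t J\<^sup>2 c\<close>
  to the multiplier, the one on the right \<open>l\<^sup>q J\<^sup>2 c\<close>.\<close>

lemma not_separates_root:
  assumes root: "l ^ 3 ^ e = t_K"
  shows "\<not> separates shears (frob e) (1 / 3 ^ e)
    (shear_diff 1 (shear_diff t_K x)) (const l * shear_diff 1 (shear_diff 1 x))"
proof
  assume "separates shears (frob e) (1 / 3 ^ e)
    (shear_diff 1 (shear_diff t_K x)) (const l * shear_diff 1 (shear_diff 1 x))"
  then obtain f where f: "f \<in> graded_homs shears (frob e) (1 / 3 ^ e)"
      "f (shear_diff 1 (shear_diff t_K x)) \<noteq> f (const l * shear_diff 1 (shear_diff 1 x))"
    by (rule separatesE)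
  obtain c where c: "\<And>x. f x = shear.tr (c * x ^ 3 ^ e)"
    "c = 0 \<or> (\<exists>m. rat_of_nat m = 3 ^ e * (1 / 3 ^ e) \<and> homogeneous m c)"
    by (rule graded_hom_is_trace[OF f(1)]) blast
  have "homogeneous 1 c"
    using c(2) by (auto simp: homogeneous_0)
  then obtain v where v: "c = linear_form v" by (rule homogeneous_1_imp_linear_form)
  have "const a ^ n = (const (a ^ n) :: (3, K) mpoly)" for a n
    by (induction n) (simp_all add: mult_single)
  then have "f (const l * shear_diff 1 (shear_diff 1 x)) =
      shear.tr (linear_form (t_K *s v) * shear_diff 1 (shear_diff 1 x) ^ 3 ^ e)"
    by (simp add: c(1) v power_mult_distrib root linear_form_scale mult_ac)
  also have "\<dots> = f (shear_diff 1 (shear_diff t_K x))"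
    by (simp add: c(1) v tr_shear_diff_diff one_in_params t_K_in_params shear_diff_diff_linear_form)
  finally show False using f(2) by simp
qed

section \<open>The invariants do not have finite Frobenius representation type\<close>

text \<open>The least degree \<open>D\<close> such that \<open>(g\<^sub>1 - 1)\<^sup>2\<close> does not vanish on \<open>H\<^sub>D(M)\<close>.\<close>

definition jump_degree :: "((3, K) mpoly, 'm) graded_module \<Rightarrow> rat \<Rightarrow> bool" where
  "jump_degree M D \<longleftrightarrow>
     (\<exists>x. separates shears M D (shear_diff 1 (shear_diff 1 x)) 0) \<and>
     (\<forall>d<D. \<forall>x. \<not> separates shears M d (shear_diff 1 (shear_diff 1 x)) 0)"

text \<open>The relation \<open>(g\<^sub>1 - 1) (g\<^sub>t - 1) = l (g\<^sub>1 - 1)\<^sup>2\<close> on \<open>H\<^sub>D(M)\<close>.\<close>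

definition slope_at :: "((3, K) mpoly, 'm) graded_module \<Rightarrow> rat \<Rightarrow> K \<Rightarrow> bool" where
  "slope_at M D l \<longleftrightarrow> (\<forall>x. \<not> separates shears M D
     (shear_diff 1 (shear_diff t_K x)) (const l * shear_diff 1 (shear_diff 1 x)))"

lemma jump_degree_unique: "jump_degree M D \<Longrightarrow> jump_degree M D' \<Longrightarrow> D = D'"
  unfolding jump_degree_def by (metis linorder_neqE)

text \<open>Two slopes give \<open>(l - l') (g\<^sub>1 - 1)\<^sup>2 = 0\<close> on \<open>H\<^sub>D(M)\<close>, and \<open>l - l'\<close> is invertible.\<close>

lemma slope_unique:
  assumes M: "graded_module invariants M" and D: "jump_degree M D"
    and l: "slope_at M D l" and l': "slope_at M D l'"
  shows "l = l'"
proof (rule ccontr)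
  assume neq: "l \<noteq> l'"
  interpret graded_module invariants M by (rule M)
  obtain x where "separates shears M D (shear_diff 1 (shear_diff 1 x)) 0"
    using D by (auto simp: jump_degree_def)
  then obtain f where f: "f \<in> graded_homs shears M D" and ne: "f (shear_diff 1 (shear_diff 1 x)) \<noteq> f 0"
    by (rule separatesE)
  \<comment> \<open>Rescaling the argument turns the difference of the two slope relations into \<open>f ?y = f 0\<close>.\<close>
  let ?x = "const (inverse (l - l')) * x" and ?y = "shear_diff 1 (shear_diff 1 x)"
  have slope: "f (shear_diff 1 (shear_diff t_K ?x)) = f (const m * shear_diff 1 (shear_diff 1 ?x))"
    if "slope_at M D m" for m
    using that f separatesI[OF f] unfolding slope_at_def by blast
  have "f (const l * shear_diff 1 (shear_diff 1 ?x)) = f (const l' * shear_diff 1 (shear_diff 1 ?x))"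
    using slope[OF l] slope[OF l'] by simp
  moreover have "const l * shear_diff 1 (shear_diff 1 ?x) =
      const l' * shear_diff 1 (shear_diff 1 ?x) + ?y"
  proof -
    have "const (l - l') * (const (inverse (l - l')) * ?y) = ?y"
      using neq by (simp add: mult_single flip: mult.assoc)
    moreover have "shear_diff 1 (shear_diff 1 ?x) = const (inverse (l - l')) * ?y"
      by (simp add: shear_diff_const_mult)
    ultimately show ?thesis
      by (simp add: single_diff algebra_simps)
  qed
  ultimately have "f (const l' * shear_diff 1 (shear_diff 1 ?x) + ?y) =
      f (const l' * shear_diff 1 (shear_diff 1 ?x) + 0)" by simp
  then have "f ?y = f 0"
    unfolding graded_homsD(2)[OF f] by (simp add: graded_homsD(1)[OF f])
  with ne show False ..
qed

lemma closed_frob: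
  "x \<in> carrier (frob e) \<Longrightarrow> y \<in> carrier (frob e) \<Longrightarrow> x \<oplus>\<^bsub>frob e\<^esub> y \<in> carrier (frob e)"
  "r \<in> carrier invariants \<Longrightarrow> x \<in> carrier (frob e) \<Longrightarrow> r \<odot>\<^bsub>frob e\<^esub> x \<in> carrier (frob e)"
  "mod_part (frob e) q \<subseteq> carrier (frob e)"
  by (auto simp: frob_simps frob_part carrier_invariants shear.invariant_def act_add act_mult act_power act_0)

text \<open>Nonvanishing in degree \<open>1 / q\<close> is inherited by some summand of \<open>\<^sup>eR\<close>; vanishing in lower
  degrees and the slope relation are inherited by all of them. The shift is arbitrary, so
  the degree that carries the relation must be recovered from the module itself: it is the least one
  in which \<open>(g\<^sub>1 - 1)\<^sup>2\<close> does not vanish.\<close>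

lemma summand_with_slope:
  assumes Ms: "\<And>M. M \<in> Ms \<Longrightarrow> graded_module invariants M"
    and Ns: "fst ` set Ns \<subseteq> Ms"
    and iso: "graded_iso invariants (frob e) (direct_sum (map (\<lambda>(M, d). shift M d) Ns))"
    and root: "l ^ 3 ^ e = t_K"
  shows "\<exists>M\<in>Ms. \<exists>D. jump_degree M D \<and> slope_at M D l"
proof -
  let ?Ns = "map (\<lambda>(M, d). shift M d) Ns"
  have mods: "\<exists>M a. graded_module invariants M \<and> ?Ns ! i = shift M a" if "i < length ?Ns" for i
  proof -
    have "fst (Ns ! i) \<in> Ms" using Ns that nth_mem[of i Ns] by auto
    then have "graded_module invariants (fst (Ns ! i))" by (rule Ms)
    moreover have "?Ns ! i = shift (fst (Ns ! i)) (snd (Ns ! i))"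
      using that by (simp add: split_beta)
    ultimately show ?thesis by blast
  qed
  have sep: "separates shears (frob e) d x y \<longleftrightarrow>
      (\<exists>i<length Ns. separates shears (fst (Ns ! i)) (snd (Ns ! i) + d) x y)" for d x y
  proof -
    have "separates shears (frob e) d x y \<longleftrightarrow> separates shears (direct_sum ?Ns) d x y"
      by (rule separates_cong[OF iso closed_frob])
    also have "\<dots> \<longleftrightarrow> (\<exists>i<length ?Ns. separates shears (?Ns ! i) d x y)"
      by (rule separates_direct_sum[OF mods])
    finally show ?thesis by (simp add: split_beta separates_shift cong: conj_cong)
  qed
  obtain x i where i: "i < length Ns" and
    x: "separates shears (fst (Ns ! i)) (snd (Ns ! i) + 1 / 3 ^ e) (shear_diff 1 (shear_diff 1 x)) 0"
    using separates_linear_degree[of e] unfolding sep by blast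
  let ?M = "fst (Ns ! i)" and ?D = "snd (Ns ! i) + 1 / 3 ^ e"
  have low: "\<not> separates shears ?M d (shear_diff 1 (shear_diff 1 y)) 0" if "d < ?D" for d y
  proof -
    have "d - snd (Ns ! i) < 1 / 3 ^ e" using that by simp
    from not_separates_low_degree[OF this, of y, unfolded sep] i show ?thesis
      by force
  qed
  have "slope_at ?M ?D l"
    using not_separates_root[OF root] i unfolding slope_at_def sep by blast
  moreover have "jump_degree ?M ?D"
    unfolding jump_degree_def using x low by blast
  moreover have "?M \<in> Ms" using Ns i nth_mem[of i Ns] by auto
  ultimately show ?thesis by blast
qed

theorem theorem1p1:
  shows "\<exists>G. subgroup G (GL :: (K^3^3) monoid) \<and> card G = 9 \<and> \<not> FFRT 3 (invariant_ring G)"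
proof (intro exI[of _ shears] conjI notI)
  assume "FFRT 3 invariants"
  then obtain Ms :: "((3, K) mpoly, (nat \<Rightarrow> (3, K) mpoly) set) graded_module set" where
    fin: "finite Ms" and Ms: "\<And>M. M \<in> Ms \<Longrightarrow> graded_module invariants M" and
    iso: "\<And>e. e \<ge> 1 \<Longrightarrow> \<exists>Ns. fst ` set Ns \<subseteq> Ms \<and>
      graded_iso invariants (frob e) (direct_sum (map (\<lambda>(M, d). shift M d) Ns))"
    unfolding FFRT_def FFRT_in_def by blast
  have "\<forall>e. \<exists>l :: K. l ^ 3 ^ e = t_K"
    by (intro allI nth_root_exists) simp
  then obtain l :: "nat \<Rightarrow> K" where l: "\<And>e. l e ^ 3 ^ e = t_K" by metis
  have "\<forall>e\<in>{1..}. \<exists>M. M \<in> Ms \<and> (\<exists>D. jump_degree M D \<and> slope_at M D (l e))"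
    using iso summand_with_slope[OF Ms _ _ l] by (meson atLeast_iff)
  then obtain M where M: "\<And>e. e \<ge> 1 \<Longrightarrow> M e \<in> Ms \<and> (\<exists>D. jump_degree (M e) D \<and> slope_at (M e) D (l e))"
    by (metis atLeast_iff)
  have "finite (M ` {1..})" using fin M by (auto intro: finite_subset)
  then have "\<not> inj_on M {1..}"
    using infinite_Ici[of "1::nat"] finite_imageD by blast
  then obtain e e' where e: "1 \<le> e" "e < e'" "M e = M e'"
    unfolding inj_on_def by (metis atLeast_iff linorder_neqE_nat)
  obtain D where D: "jump_degree (M e) D" "slope_at (M e) D (l e)" using M e(1) by blast
  obtain D' where D': "jump_degree (M e') D'" "slope_at (M e') D' (l e')" using M e by (metis le_trans less_imp_le)
  have "l e = l e'"
    using slope_unique[OF Ms D] M e D' jump_degree_unique D(1) by metis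
  \<comment> \<open>The exponents satisfy \<open>3 ^ e' = 3 ^ e * 3 ^ (e' - e)\<close>, so a common root makes \<open>t\<close> a proper power of itself.\<close>
  then have "t_K ^ 1 = (l e ^ 3 ^ e) ^ 3 ^ (e' - e)"
    using l[of e'] e(2) by (simp flip: power_mult power_add)
  also have "\<dots> = t_K ^ 3 ^ (e' - e)" by (simp only: l)
  finally have "1 = (3 :: nat) ^ (e' - e)" by (simp only: t_K_power_inject)
  moreover have "1 < (3 :: nat) ^ (e' - e)" using e(2) by (intro one_less_power) simp_all
  ultimately show False by simp
qed (fact subgroup_shears card_shears)+

end
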